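(* Let $U:\mathbb{R}\to(-\infty,\infty]$ be measurable with $U(x)=U(-x)$, $\inf_x U(x)>-\infty$, $0<\int e^{-U(x)}dx<\infty$, and suppose that either $U(x)<\infty$ for all $x$, or there is $0<K<\infty$ with $U(x)<\infty$ for $|x|<K$ and $U(x)=\infty$ for $|x|>K$. Then for every $0<\delta<1$ there exists $0<L<\infty$ such that for all $n\ge1$, $U$ has $(\delta,L)$-controlled gradients on $\mathbb{T}_n^2$.
   Context: For $n\ge1$, $\mathbb{T}_n^2$ is the discrete torus with vertex set $V(\mathbb{T}_n^2)=\{-n+1,\dots,n\}^2$, where $(a,b)$ and $(c,d)$ are adjacent if they agree in one coordinate and differ by exactly $1$ modulo $2n$ in the other; $E(\mathbb{T}_n^2)$ is its edge set and $\mathbf 0=(0,0)$. $\mu_{\mathbb{T}_n^2,\mathbf 0,U}$ is the probability measure on $\varphi:V(\mathbb{T}_n^2)\to\mathbb{R}$ with density $Z^{-1}\exp(-\sum_{(v,w)\in E(\mathbb{T}_n^2)}U(\varphi_v-\varphi_w))$ with respect to $\delta_0(d\varphi_{\mathbf 0})\prod_{v\ne\mathbf 0}d\varphi_v$. For $0<L<\infty$ and $0<\delta<1$, $U$ has $(\delta,L)$-controlled gradients on $\mathbb{T}_n^2$ if: (1) there is $K>L$ with $U(x)<\infty$ for $|x|<K$; and (2) if $\varphi\sim\mu_{\mathbb{T}_n^2,\mathbf 0,U}$ and $\mathcal{E}(\varphi,L):=\{(v,w)\in E(\mathbb{T}_n^2):|\varphi_v-\varphi_w|\ge L\}$, then $\mathbb{P}(e_1,\dots,e_k\in\mathcal{E}(\varphi,L))\le\delta^k$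 for all $k\ge1$ and all distinct $e_1,\dots,e_k\in E(\mathbb{T}_n^2)$. *)

theory Defs
  imports "HOL-Probability.Probability"
begin

definition torus_V :: "nat \<Rightarrow> (int \<times> int) set" where
  "torus_V n = {- int n + 1 .. int n} \<times> {- int n + 1 .. int n}"

definition diff_one_mod :: "nat \<Rightarrow> int \<Rightarrow> int \<Rightarrow> bool" where
  "diff_one_mod n x y \<longleftrightarrow> (x - y) mod (2 * int n) = 1 \<or> (y - x) mod (2 * int n) = 1"

definition torus_adj :: "nat \<Rightarrow> int \<times> int \<Rightarrow> int \<times> int \<Rightarrow> bool" where
  "torus_adj n v w \<longleftrightarrow> v \<in> torus_V n \<and> w \<in> torus_V n \<and>
     ((fst v = fst w \<and> diff_one_mod n (snd v) (snd w)) \<or>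
      (snd v = snd w \<and> diff_one_mod n (fst v) (fst w)))"

text \<open>Edge set E(T_n^2): each undirected edge is represented exactly once, as the
  ordered pair (v,w) with v lexicographically smaller than w.\<close>
definition torus_E :: "nat \<Rightarrow> ((int \<times> int) \<times> (int \<times> int)) set" where
  "torus_E n = {(v, w). torus_adj n v w \<and>
                  (fst v < fst w \<or> (fst v = fst w \<and> snd v < snd w))}"

definition exp_neg :: "ereal \<Rightarrow> ennreal" where
  "exp_neg x = (if x = \<infinity> then 0 else if x = -\<infinity> then \<infinity>
                else ennreal (exp (- real_of_ereal x)))"

definition hamiltonian :: "nat \<Rightarrow> (real \<Rightarrow> ereal) \<Rightarrow> (int \<times> int \<Rightarrow> real) \<Rightarrow> ereal" where
  "hamiltonian n U \<phi> = (\<Sum>(v, w)\<in>torus_E n. U (\<phi> v - \<phi> w))"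

definition ref_measure :: "nat \<Rightarrow> (int \<times> int \<Rightarrow> real) measure" where
  "ref_measure n = PiM (torus_V n) (\<lambda>v. if v = (0, 0) then return lborel 0 else lborel)"

definition partition_fn :: "nat \<Rightarrow> (real \<Rightarrow> ereal) \<Rightarrow> ennreal" where
  "partition_fn n U = (\<integral>\<^sup>+ \<phi>. exp_neg (hamiltonian n U \<phi>) \<partial>ref_measure n)"

definition gibbs_prob :: "nat \<Rightarrow> (real \<Rightarrow> ereal) \<Rightarrow> (int \<times> int \<Rightarrow> real) set \<Rightarrow> ennreal" where
  "gibbs_prob n U A =
     (\<integral>\<^sup>+ \<phi>. exp_neg (hamiltonian n U \<phi>) * indicator A \<phi> \<partial>ref_measure n) / partition_fn n U"

text \<open>(delta,L)-controlled gradients on T_n^2. Distinct edges e_1..e_k (k>=1) are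
  encoded as a finite nonempty set S of edges with card S = k. We also record that the
  Gibbs measure is well defined (0 < Z < \<infinity>), which the definition presupposes.\<close>
definition controlled_gradients :: "real \<Rightarrow> real \<Rightarrow> nat \<Rightarrow> (real \<Rightarrow> ereal) \<Rightarrow> bool" where
  "controlled_gradients \<delta> L n U \<longleftrightarrow>
     (\<exists>K>L. \<forall>x. \<bar>x\<bar> < K \<longrightarrow> U x < \<infinity>) \<and>
     0 < partition_fn n U \<and> partition_fn n U < \<infinity> \<and>
     (\<forall>S. S \<subseteq> torus_E n \<longrightarrow> S \<noteq> {} \<longrightarrow>
        gibbs_prob n U {\<phi>. \<forall>(v, w)\<in>S. \<bar>\<phi> v - \<phi> w\<bar> \<ge> L} \<le> ennreal (\<delta> ^ card S))"

end

theory Submission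
  imports Defs
begin

text \<open>
  The weight \<open>exp (- \<Sum> U)\<close> is reflection positive with respect to the axes of the torus that pass through
  vertices: given the heights on the axis, the two halves are independent, so Cauchy--Schwarz bounds the weight of
  an event by those of its two symmetrised versions. Applied to all vertical axes this chessboard argument spreads a set
  of large horizontal edges over full rows, and applied to all horizontal axes it spreads a family of full rows of one
  parity over all rows of that parity. Hence the probability that the edges of \<open>S\<close> are large is at most a power
  of the probability that all horizontal edges in the rows of one parity are large, with exponent proportional to
  \<open>card S / n\<^sup>2\<close>. The latter probability is at most \<open>(C \<tau>)^(n\<^sup>2)\<close>, where \<open>\<tau>\<close> is the mass of
  \<open>exp (- U)\<close> beyond \<open>L\<close>: bound the numerator by integrating along a spanning tree, and the partition function from below
  by choosing the heights one after the other in a small interval while avoiding a set of small measure.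
  Finally \<open>\<tau>\<close> becomes arbitrarily small as \<open>L\<close> approaches the edge of the region where \<open>U\<close> is finite.
  Every edge is used in both orientations with weight \<open>exp (- U / 2)\<close>, which makes edge sets stable under reflections.
\<close>

section \<open>The chessboard estimate for periodic words\<close>

definition offset :: "nat \<Rightarrow> int \<Rightarrow> int \<Rightarrow> int" where
  "offset n j x = (x - j) mod (2 * int n)"

lemma offset_bounds: "n \<ge> 1 \<Longrightarrow> 0 \<le> offset n j x \<and> offset n j x < 2 * int n"
  by (simp add: offset_def)

lemma offset_cong: "x mod (2 * int n) = y mod (2 * int n) \<Longrightarrow> offset n j x = offset n j y"
  unfolding offset_def by (rule mod_diff_cong) simp_all

lemma offset_eq_0_iff: "offset n j x = 0 \<longleftrightarrow> x mod (2 * int n) = j mod (2 * int n)"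
  by (simp add: offset_def mod_eq_dvd_iff mod_eq_0_iff_dvd)

lemma offset_Suc:
  assumes "n \<ge> 1"
  shows "offset n j (x + 1) = (if offset n j x = 2 * int n - 1 then 0 else offset n j x + 1)"
proof -
  have "offset n j (x + 1) = (offset n j x + 1) mod (2 * int n)"
    by (simp add: offset_def mod_add_left_eq diff_add_eq)
  also have "\<dots> = (if offset n j x = 2 * int n - 1 then 0 else offset n j x + 1)"
    using offset_bounds[OF assms, of j x] by auto
  finally show ?thesis .
qed

lemma offset_pred:
  assumes "n \<ge> 1"
  shows "offset n j (x - 1) = (if offset n j x = 0 then 2 * int n - 1 else offset n j x - 1)"
  using offset_Suc[OF assms, of j "x - 1"] offset_bounds[OF assms, of j "x - 1"] by (auto split: if_splits)

lemma offset_reflect: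
  "offset n j (2 * j - x) = (if offset n j x = 0 then 0 else 2 * int n - offset n j x)"
proof -
  have "offset n j (2 * j - x) = (- (x - j)) mod (2 * int n)" by (simp add: offset_def)
  then show ?thesis by (simp only: zmod_zminus1_eq_if offset_def)
qed

lemma offset_reflect_pred:
  assumes "n \<ge> 1"
  shows "offset n j (2 * j - 1 - x) = 2 * int n - 1 - offset n j x"
  using offset_pred[OF assms, of j "2 * j - x"] offset_reflect[of n j x] offset_bounds[OF assms, of j x]
  by (auto simp: diff_diff_eq add.commute)

lemma offset_opposite:
  assumes "n \<ge> 1"
  shows "offset n (j + int n) x = (if offset n j x < int n then offset n j x + int n else offset n j x - int n)"
proof -
  have "offset n (j + int n) x = (offset n j x - int n) mod (2 * int n)"
    by (simp add: offset_def mod_diff_left_eq diff_diff_eq)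
  also have "\<dots> = (if offset n j x < int n then offset n j x + int n else offset n j x - int n)"
    using offset_bounds[OF assms, of j x] int_mod_pos_eq[of "offset n j x - int n" "2 * int n" "- 1"]
    by auto
  finally show ?thesis .
qed

lemma offset_shift:
  assumes "n \<ge> 1"
  shows "offset n (j - 1) x = (if offset n j x = 2 * int n - 1 then 0 else offset n j x + 1)"
proof -
  have "offset n (j - 1) x = offset n j (x + 1)" by (simp add: offset_def algebra_simps)
  then show ?thesis by (simp only: offset_Suc[OF assms])
qed

definition periodic_words :: "nat \<Rightarrow> 'a set \<Rightarrow> (int \<Rightarrow> 'a) set" where
  "periodic_words n A = {c. range c \<subseteq> A \<and> (\<forall>i j. i mod (2 * int n) = j mod (2 * int n) \<longrightarrow> c i = c j)}"

lemma periodic_wordsI: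
  assumes "\<And>i. c i \<in> A" "\<And>i j. i mod (2 * int n) = j mod (2 * int n) \<Longrightarrow> c i = c j"
  shows "c \<in> periodic_words n A"
  unfolding periodic_words_def using assms by blast

lemma periodic_words_in: "c \<in> periodic_words n A \<Longrightarrow> c i \<in> A"
  unfolding periodic_words_def by blast

lemma periodic_words_cong:
  "c \<in> periodic_words n A \<Longrightarrow> i mod (2 * int n) = j mod (2 * int n) \<Longrightarrow> c i = c j"
  unfolding periodic_words_def by blast

lemma finite_periodic_words:
  assumes "n \<ge> 1" "finite A"
  shows "finite (periodic_words n A)"
proof -
  let ?I = "{0..<2 * int n}"
  have "inj_on (\<lambda>c. restrict c ?I) (periodic_words n A)"
  proof (rule inj_onI, rule ext)
    fix c d :: "int \<Rightarrow> 'a" and i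
    assume words: "c \<in> periodic_words n A" "d \<in> periodic_words n A"
      and eq: "restrict c ?I = restrict d ?I"
    have "i mod (2 * int n) \<in> ?I" using assms by simp
    then have "c (i mod (2 * int n)) = d (i mod (2 * int n))"
      using fun_cong[OF eq, of "i mod (2 * int n)"] by simp
    then show "c i = d i"
      using words[THEN periodic_words_cong, of "i mod (2 * int n)" i] by simp
  qed
  moreover have "(\<lambda>c. restrict c ?I) ` periodic_words n A \<subseteq> PiE ?I (\<lambda>_. A)"
    using periodic_words_in by auto
  ultimately show ?thesis
    using assms by (meson finite_PiE finite_atLeastLessThan_int finite_imageD finite_subset)
qed

text \<open>Letter \<open>i\<close> sits between the sites \<open>i\<close> and \<open>i + 1\<close>, so the reflection in the site \<open>j\<close> maps it to the letter
  \<open>2 * j - 1 - i\<close>.\<close>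

definition fold_word :: "nat \<Rightarrow> int \<Rightarrow> (int \<Rightarrow> 'a) \<Rightarrow> int \<Rightarrow> 'a" where
  "fold_word n j c i = (if offset n j i < int n then c i else c (2 * j - 1 - i))"

lemma fold_word_in_periodic_words:
  assumes "c \<in> periodic_words n A"
  shows "fold_word n j c \<in> periodic_words n A"
proof (rule periodic_wordsI)
  show "fold_word n j c i \<in> A" for i
    using assms by (simp add: fold_word_def periodic_words_in)
  show "fold_word n j c i = fold_word n j c i'" if "i mod (2 * int n) = i' mod (2 * int n)" for i i'
    unfolding fold_word_def offset_cong[OF that]
    using periodic_words_cong[OF assms that] periodic_words_cong[OF assms mod_diff_cong[OF refl that]] by simp
qed

lemma fold_word_opposite:
  assumes "n \<ge> 1" "c \<in> periodic_words n A"
  shows "fold_word n (j + int n) c i = (if offset n j i < int n then c (2 * j - 1 - i) else c i)"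
proof -
  have "c (2 * (j + int n) - 1 - i) = c (2 * j - 1 - i)"
  proof (rule periodic_words_cong[OF assms(2)])
    have "2 * (j + int n) - 1 - i = (2 * j - 1 - i) + 2 * int n" by simp
    then show "(2 * (j + int n) - 1 - i) mod (2 * int n) = (2 * j - 1 - i) mod (2 * int n)"
      by (metis mod_add_self2)
  qed
  then show ?thesis
    using offset_bounds[OF assms(1), of j i] by (simp add: fold_word_def offset_opposite[OF assms(1)])
qed

lemma sum_fold_word:
  fixes g :: "'a \<Rightarrow> real"
  assumes n_pos: "n \<ge> 1" and word: "c \<in> periodic_words n A"
  shows "(\<Sum>i\<in>{0..<2 * int n}. g (fold_word n j c i)) + (\<Sum>i\<in>{0..<2 * int n}. g (fold_word n (j + int n) c i))
         = 2 * (\<Sum>i\<in>{0..<2 * int n}. g (c i))"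
proof -
  let ?I = "{0..<2 * int n}" and ?r = "\<lambda>i. (2 * j - 1 - i) mod (2 * int n)"
  have "(\<Sum>i\<in>?I. g (fold_word n j c i)) + (\<Sum>i\<in>?I. g (fold_word n (j + int n) c i))
      = (\<Sum>i\<in>?I. g (c i)) + (\<Sum>i\<in>?I. g (c (2 * j - 1 - i)))"
    unfolding sum.distrib[symmetric] fold_word_opposite[OF n_pos word] by (rule sum.cong) (auto simp: fold_word_def)
  also have "(\<Sum>i\<in>?I. g (c (2 * j - 1 - i))) = (\<Sum>i\<in>?I. g (c (?r i)))"
    by (intro sum.cong refl arg_cong[where f = g] periodic_words_cong[OF word]) simp
  also have "\<dots> = (\<Sum>i\<in>?I. g (c i))"
  proof (rule sum.reindex_bij_witness[of _ ?r ?r])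
    show "?r (?r i) = i" if "i \<in> ?I" for i using that by (simp add: mod_diff_right_eq)
  qed (use n_pos in \<open>auto simp: mod_diff_right_eq\<close>)
  finally show ?thesis by simp
qed

text \<open>Folding at the left end of a constant run mirrors the run and hence lengthens it.\<close>

lemma constant_word_in_fold_closed:
  assumes n_pos: "n \<ge> 1" and Q_words: "Q \<subseteq> periodic_words n A" "c \<in> Q"
    and closed: "\<And>d j. d \<in> Q \<Longrightarrow> fold_word n j d \<in> Q"
  obtains a where "(\<lambda>_. a) \<in> Q"
proof -
  define a where "a = c 0"
  have "1 \<le> r \<Longrightarrow> \<exists>d\<in>Q. \<exists>s. \<forall>i. offset n s i < r \<longrightarrow> d i = a" for r :: int
  proof (induction r rule: int_ge_induct)
    case base
    have "c i = a" if "offset n 0 i < 1" for i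
    proof -
      have "offset n 0 i = 0" using that offset_bounds[OF n_pos, of 0 i] by simp
      then show ?thesis
        unfolding a_def offset_eq_0_iff using Q_words by (intro periodic_words_cong[of c n A]) auto
    qed
    then show ?case using Q_words(2) by blast
  next
    case (step r)
    then obtain d s where "d \<in> Q" and run: "\<And>i. offset n s i < r \<Longrightarrow> d i = a" by blast
    have "fold_word n s d i = a" if i: "offset n (s - 1) i < r + 1" for i
    proof (cases "offset n s i < int n")
      case True
      then have "offset n s i < r"
        using i step.hyps offset_shift[OF n_pos, of s i] n_pos by (auto split: if_splits)
      then show ?thesis using True run by (simp add: fold_word_def)
    next
      case False
      then have "offset n s (2 * s - 1 - i) < r"
        using i step.hyps offset_shift[OF n_pos, of s i] offset_bounds[OF n_pos, of s i]
        by (auto simp: offset_reflect_pred[OF n_pos] split: if_splits)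
      then show ?thesis using False run by (simp add: fold_word_def)
    qed
    then show ?case using closed[OF \<open>d \<in> Q\<close>] by blast
  qed
  from this[of "2 * int n"] obtain d s where "d \<in> Q" "\<And>i. offset n s i < 2 * int n \<Longrightarrow> d i = a"
    using n_pos by auto
  then have "d = (\<lambda>_. a)" using offset_bounds[OF n_pos] by auto
  then show thesis using \<open>d \<in> Q\<close> that by simp
qed

lemma fold_word_maximum_principle:
  fixes F :: "(int \<Rightarrow> 'a) \<Rightarrow> real"
  assumes n_pos: "n \<ge> 1" and finite_A: "finite A" and word: "c \<in> periodic_words n A"
    and fold: "\<And>d j. d \<in> periodic_words n A \<Longrightarrow>
      2 * F d \<le> F (fold_word n j d) + F (fold_word n (j + int n) d)"
  obtains a where "F c \<le> F (\<lambda>_. a)"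
proof -
  define M where "M = Max (F ` periodic_words n A)"
  define Q where "Q = {d \<in> periodic_words n A. F d = M}"
  have fin: "finite (F ` periodic_words n A)" using finite_periodic_words[OF n_pos finite_A] by simp
  then have F_le_M: "F d \<le> M" if "d \<in> periodic_words n A" for d
    using that by (simp add: M_def)
  have "M \<in> F ` periodic_words n A"
    unfolding M_def using fin word by (intro Max_in) auto
  then obtain m where "m \<in> Q" by (auto simp: Q_def)
  moreover have "fold_word n j d \<in> Q" if "d \<in> Q" for d j
  proof -
    have word_d: "d \<in> periodic_words n A" "F d = M" using that by (auto simp: Q_def)
    note words = fold_word_in_periodic_words[OF word_d(1)]
    have "F (fold_word n j d) = M"
      using fold[OF word_d(1), of j] word_d(2) F_le_M[OF words[of j]] F_le_M[OF words[of "j + int n"]] by linarith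
    then show ?thesis using words by (simp add: Q_def)
  qed
  ultimately obtain a where "(\<lambda>_. a) \<in> Q"
    using constant_word_in_fold_closed[OF n_pos, of Q A m] by (auto simp: Q_def)
  then have "F (\<lambda>_. a) = M" by (simp add: Q_def)
  then show thesis using that[of a] F_le_M[OF word] by simp
qed

lemma chessboard_estimate_positive:
  fixes \<Phi> :: "(int \<Rightarrow> 'a) \<Rightarrow> real"
  assumes n_pos: "n \<ge> 1" and finite_A: "finite A" and word: "c \<in> periodic_words n A" and pos: "\<And>c. 0 < \<Phi> c"
    and reflection: "\<And>d j. d \<in> periodic_words n A \<Longrightarrow>
      (\<Phi> d)\<^sup>2 \<le> \<Phi> (fold_word n j d) * \<Phi> (fold_word n (j + int n) d)"
  shows "\<Phi> c ^ (2 * n) \<le> (\<Prod>i\<in>{0..<2 * int n}. \<Phi> (\<lambda>_. c i))"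
proof -
  let ?I = "{0..<2 * int n}"
  define F where "F = (\<lambda>d. 2 * real n * ln (\<Phi> d) - (\<Sum>i\<in>?I. ln (\<Phi> (\<lambda>_. d i))))"
  have "2 * F d \<le> F (fold_word n j d) + F (fold_word n (j + int n) d)" if word_d: "d \<in> periodic_words n A" for d j
  proof -
    let ?l = "\<Phi> (fold_word n j d)" and ?r = "\<Phi> (fold_word n (j + int n) d)"
    have "ln ((\<Phi> d)\<^sup>2) \<le> ln (?l * ?r)"
      using reflection[OF word_d, of j] pos by (intro ln_mono zero_less_power)
    then have "2 * ln (\<Phi> d) \<le> ln ?l + ln ?r"
      using less_imp_neq[OF pos, symmetric] by (simp add: ln_realpow ln_mult pos)
    then have "2 * real n * (2 * ln (\<Phi> d)) \<le> 2 * real n * (ln ?l + ln ?r)"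
      by (intro mult_left_mono) simp_all
    then show ?thesis
      using sum_fold_word[OF n_pos word_d, of "\<lambda>a. ln (\<Phi> (\<lambda>_. a))" j] by (simp add: F_def algebra_simps)
  qed
  then obtain a where "F c \<le> F (\<lambda>_. a)"
    by (rule fold_word_maximum_principle[OF n_pos finite_A word])
  also have "F (\<lambda>_. a) = 0" by (simp add: F_def)
  finally have "ln (\<Phi> c ^ (2 * n)) \<le> ln (\<Prod>i\<in>?I. \<Phi> (\<lambda>_. c i))"
    using less_imp_neq[OF pos, symmetric] by (subst ln_prod) (auto simp: F_def ln_realpow)
  then show ?thesis
    using pos by (subst (asm) ln_le_cancel_iff) (auto intro!: prod_pos)
qed

lemma chessboard_estimate:
  fixes \<Phi> :: "(int \<Rightarrow> 'a) \<Rightarrow> real"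
  assumes n_pos: "n \<ge> 1" and finite_A: "finite A" and word: "c \<in> periodic_words n A" and nonneg: "\<And>c. 0 \<le> \<Phi> c"
    and reflection: "\<And>d j. d \<in> periodic_words n A \<Longrightarrow>
      (\<Phi> d)\<^sup>2 \<le> \<Phi> (fold_word n j d) * \<Phi> (fold_word n (j + int n) d)"
  shows "\<Phi> c ^ (2 * n) \<le> (\<Prod>i\<in>{0..<2 * int n}. \<Phi> (\<lambda>_. c i))"
proof (rule tendsto_le[of "at_right (0::real)"])
  show "\<forall>\<^sub>F e in at_right 0. (\<Phi> c + e) ^ (2 * n) \<le> (\<Prod>i\<in>{0..<2 * int n}. (\<Phi> (\<lambda>_. c i) + e))"
  proof (rule eventually_at_rightI[of 0 1])
    fix e :: real assume "e \<in> {0<..<1}"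
    then have e_pos: "0 < e" by simp
    show "(\<Phi> c + e) ^ (2 * n) \<le> (\<Prod>i\<in>{0..<2 * int n}. (\<Phi> (\<lambda>_. c i) + e))"
    proof (rule chessboard_estimate_positive[OF n_pos finite_A word])
      show "0 < \<Phi> d + e" for d using nonneg[of d] e_pos by linarith
      fix d j assume word_d: "d \<in> periodic_words n A"
      let ?l = "\<Phi> (fold_word n j d)" and ?r = "\<Phi> (fold_word n (j + int n) d)"
      have "\<Phi> d \<le> sqrt (?l * ?r)" using reflection[OF word_d] by (rule real_le_rsqrt)
      also have "\<dots> \<le> (?l + ?r) / 2" by (rule arith_geo_mean_sqrt) (rule nonneg)+
      finally have "e * (2 * \<Phi> d) \<le> e * (?l + ?r)" using e_pos by simp
      then show "(\<Phi> d + e)\<^sup>2 \<le> (?l + e) * (?r + e)"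
        using reflection[OF word_d, of j] by (simp add: power2_eq_square algebra_simps)
    qed
  qed simp
  show "((\<lambda>e. (\<Phi> c + e) ^ (2 * n)) \<longlongrightarrow> \<Phi> c ^ (2 * n)) (at_right 0)"
    by (rule tendsto_eq_intros refl | simp)+
  show "((\<lambda>e. \<Prod>i\<in>{0..<2 * int n}. (\<Phi> (\<lambda>_. c i) + e)) \<longlongrightarrow> (\<Prod>i\<in>{0..<2 * int n}. \<Phi> (\<lambda>_. c i))) (at_right 0)"
    by (rule tendsto_eq_intros refl | simp)+
qed simp

section \<open>Gradient integrands on a finite vertex set\<close>

abbreviation leb :: "'v set \<Rightarrow> ('v \<Rightarrow> real) measure" where
  "leb V \<equiv> PiM V (\<lambda>_. lborel)"

interpretation leb: product_sigma_finite "\<lambda>_. lborel :: real measure"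
  by standard

lemma emeasure_lborel_vimage_shift:
  fixes A :: "real set"
  assumes "A \<in> sets borel"
  shows "(\<lambda>x. x + t) -` A \<in> sets borel" "emeasure lborel ((\<lambda>x. x + t) -` A) = emeasure lborel A"
proof -
  show "(\<lambda>x. x + t) -` A \<in> sets borel"
    by (rule measurable_sets_borel[OF _ assms]) simp
  have "emeasure lborel A = emeasure (distr lborel borel ((+) t)) A"
    by (simp add: lborel_distr_plus)
  also have "\<dots> = emeasure lborel ((\<lambda>x. x + t) -` A)"
    using assms by (subst emeasure_distr) (auto simp: vimage_def add.commute)
  finally show "emeasure lborel ((\<lambda>x. x + t) -` A) = emeasure lborel A" ..
qed

lemma measurable_reindex_shift:
  "bij_betw s V W \<Longrightarrow> (\<lambda>y. \<lambda>v\<in>V. y (s v) + t v) \<in> measurable (leb W) (leb V)"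
  by (intro measurable_restrict borel_measurable_add measurable_component_singleton) (auto simp: bij_betw_def)

lemma distr_leb_reindex_shift:
  fixes t :: "'v \<Rightarrow> real"
  assumes V: "finite V" and W: "finite W" and bij_s: "bij_betw s V W"
  shows "distr (leb W) (leb V) (\<lambda>y. \<lambda>v\<in>V. y (s v) + t v) = leb V"
proof (rule leb.PiM_eqI[OF V])
  fix A :: "'v \<Rightarrow> real set" assume A_sets: "\<And>v. v \<in> V \<Longrightarrow> A v \<in> sets lborel"
  let ?T = "\<lambda>y. \<lambda>v\<in>V. y (s v) + t v"
  define B where "B = (\<lambda>v. (\<lambda>x. x + t v) -` A v)"
  have B_shift: "B v \<in> sets borel" "emeasure lborel (B v) = emeasure lborel (A v)" if "v \<in> V" for v
    using emeasure_lborel_vimage_shift[of "A v" "t v"] A_sets[OF that] by (simp_all add: B_def)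
  have inv_into_W: "inv_into V s w \<in> V" "s (inv_into V s w) = w" if "w \<in> W" for w
    using that bij_s bij_betw_inv_into[OF bij_s] by (auto simp: bij_betw_inv_into_right intro: bij_betw_apply)
  have inv_into_V: "inv_into V s (s v) = v" "s v \<in> W" if "v \<in> V" for v
    using that bij_s by (auto simp: bij_betw_inv_into_left intro: bij_betw_apply)
  have "?T -` Pi\<^sub>E V A \<inter> space (leb W) = Pi\<^sub>E W (\<lambda>w. B (inv_into V s w))"
  proof (rule set_eqI)
    fix y
    have "y \<in> ?T -` Pi\<^sub>E V A \<inter> space (leb W) \<longleftrightarrow> (\<forall>v\<in>V. y (s v) \<in> B v) \<and> y \<in> extensional W"
      by (auto simp: space_PiM PiE_iff B_def)
    also have "(\<forall>v\<in>V. y (s v) \<in> B v) \<longleftrightarrow> (\<forall>w\<in>W. y w \<in> B (inv_into V s w))"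
      using inv_into_W inv_into_V by (metis (no_types, lifting))
    finally show "y \<in> ?T -` Pi\<^sub>E V A \<inter> space (leb W) \<longleftrightarrow> y \<in> Pi\<^sub>E W (\<lambda>w. B (inv_into V s w))"
      unfolding PiE_iff .
  qed
  then have "emeasure (distr (leb W) (leb V) ?T) (Pi\<^sub>E V A) = emeasure (leb W) (Pi\<^sub>E W (\<lambda>w. B (inv_into V s w)))"
    using A_sets V measurable_reindex_shift[OF bij_s] by (subst emeasure_distr) (auto intro!: sets_PiM_I_finite)
  also have "\<dots> = (\<Prod>w\<in>W. emeasure lborel (B (inv_into V s w)))"
    using W B_shift(1) inv_into_W(1) by (intro leb.emeasure_PiM) auto
  also have "\<dots> = (\<Prod>v\<in>V. emeasure lborel (B v))"
    by (subst prod.reindex_bij_betw[OF bij_s, symmetric]) (simp add: inv_into_V)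
  also have "\<dots> = (\<Prod>v\<in>V. emeasure lborel (A v))" by (simp add: B_shift(2))
  finally show "emeasure (distr (leb W) (leb V) ?T) (Pi\<^sub>E V A) = (\<Prod>v\<in>V. emeasure lborel (A v))" .
qed simp

lemma nn_integral_leb_reindex_shift:
  fixes t :: "'v \<Rightarrow> real"
  assumes "finite V" "finite W" and bij_s: "bij_betw s V W" and f_measurable: "f \<in> borel_measurable (leb V)"
  shows "(\<integral>\<^sup>+ y. f (\<lambda>v\<in>V. y (s v) + t v) \<partial>leb W) = (\<integral>\<^sup>+ x. f x \<partial>leb V)"
  using nn_integral_distr[OF measurable_reindex_shift[OF bij_s]] f_measurable
  by (simp add: distr_leb_reindex_shift[OF assms(1-3)])

corollary nn_integral_leb_reindex:
  assumes "finite V" "finite W" "bij_betw s V W" "f \<in> borel_measurable (leb V)"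
  shows "(\<integral>\<^sup>+ y. f (\<lambda>v\<in>V. y (s v)) \<partial>leb W) = (\<integral>\<^sup>+ x. f x \<partial>leb V)"
  using nn_integral_leb_reindex_shift[OF assms, of "\<lambda>_. 0"] by simp

corollary nn_integral_leb_shift:
  assumes "finite V" "f \<in> borel_measurable (leb V)"
  shows "(\<integral>\<^sup>+ x. f (\<lambda>v\<in>V. x v + t) \<partial>leb V) = (\<integral>\<^sup>+ x. f x \<partial>leb V)"
  using nn_integral_leb_reindex_shift[OF assms(1,1) bij_betw_id assms(2), of "\<lambda>_. t"] by simp

definition translation_invariant :: "'v set \<Rightarrow> (('v \<Rightarrow> real) \<Rightarrow> 'c) \<Rightarrow> bool" where
  "translation_invariant V F \<longleftrightarrow> (\<forall>x t. F (\<lambda>v\<in>V. x v + t) = F x)"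

text \<open>Smearing the pinned coordinate over \<open>[0,1]\<close> instead of fixing it at \<open>0\<close> keeps the reference measure
  a Lebesgue measure and does not change the integral of a translation invariant function.\<close>

definition pinned_integral :: "'v set \<Rightarrow> 'v \<Rightarrow> (('v \<Rightarrow> real) \<Rightarrow> ennreal) \<Rightarrow> ennreal" where
  "pinned_integral V p F = (\<integral>\<^sup>+ x. indicator {0..1} (x p) * F x \<partial>leb V)"

lemma borel_measurable_pin:
  "p \<in> V \<Longrightarrow> (\<lambda>x. indicator {0..1::real} (x p) :: ennreal) \<in> borel_measurable (leb V)"
  by measurable

lemma pinned_integral_mono:
  "(\<And>x. F x \<le> G x) \<Longrightarrow> pinned_integral V p F \<le> pinned_integral V p G"
  unfolding pinned_integral_def by (intro nn_integral_mono mult_left_mono) auto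

lemma nn_integral_indicator_unit:
  "(\<integral>\<^sup>+ t. indicator {0..1} (a + t) \<partial>lborel) = 1" "(\<integral>\<^sup>+ t. indicator {0..1} (a - t) \<partial>lborel) = 1"
  for a :: real
proof -
  have "indicator {0..1} (a + t) = (indicator {-a..1-a} t :: ennreal)"
    "indicator {0..1} (a - t) = (indicator {a-1..a} t :: ennreal)" for t
    by (auto simp: indicator_def)
  then show "(\<integral>\<^sup>+ t. indicator {0..1} (a + t) \<partial>lborel) = 1"
    "(\<integral>\<^sup>+ t. indicator {0..1} (a - t) \<partial>lborel) = 1" by simp_all
qed

lemma pinned_integral_vertex_indep:
  assumes V: "finite V" "p \<in> V" "q \<in> V"
    and [measurable]: "F \<in> borel_measurable (leb V)" and invariant: "translation_invariant V F"
  shows "pinned_integral V p F = pinned_integral V q F"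
proof -
  interpret P: pair_sigma_finite "leb V" "lborel :: real measure"
    using leb.sigma_finite[OF V(1)] by (simp add: pair_sigma_finite_def sigma_finite_lborel)
  note [measurable] = V(2,3)
  let ?I = "\<lambda>s. indicator {0..1::real} s :: ennreal"
  have "pinned_integral V p F = (\<integral>\<^sup>+ x. (\<integral>\<^sup>+ t. ?I (x p) * F x * ?I (x q + t) \<partial>lborel) \<partial>leb V)"
    unfolding pinned_integral_def by (simp add: nn_integral_cmult nn_integral_indicator_unit)
  also have "\<dots> = (\<integral>\<^sup>+ t. (\<integral>\<^sup>+ x. ?I (x p) * F x * ?I (x q + t) \<partial>leb V) \<partial>lborel)"
    by (rule P.Fubini'[symmetric]) measurable
  also have "\<dots> = (\<integral>\<^sup>+ t. (\<integral>\<^sup>+ x. ?I (x p - t) * F x * ?I (x q) \<partial>leb V) \<partial>lborel)"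
  proof (rule nn_integral_cong)
    fix t :: real
    have "(\<lambda>x. ?I (x p - t) * F x * ?I (x q)) \<in> borel_measurable (leb V)" by measurable
    from nn_integral_leb_shift[OF V(1) this, of t]
    show "(\<integral>\<^sup>+ x. ?I (x p) * F x * ?I (x q + t) \<partial>leb V) = (\<integral>\<^sup>+ x. ?I (x p - t) * F x * ?I (x q) \<partial>leb V)"
      using V invariant by (simp add: translation_invariant_def)
  qed
  also have "\<dots> = (\<integral>\<^sup>+ x. (\<integral>\<^sup>+ t. ?I (x p - t) * F x * ?I (x q) \<partial>lborel) \<partial>leb V)"
    by (rule P.Fubini') measurable
  also have "\<dots> = pinned_integral V q F"
    unfolding pinned_integral_def
    by (simp add: nn_integral_multc nn_integral_indicator_unit mult.commute[of "F _"])
  finally show ?thesis .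
qed

lemma pinned_integral_permute:
  assumes V: "finite V" "p \<in> V" and bij_s: "bij_betw s V V" and F_measurable: "F \<in> borel_measurable (leb V)"
  shows "pinned_integral V (s p) (\<lambda>y. F (\<lambda>v\<in>V. y (s v))) = pinned_integral V p F"
proof -
  have "(\<lambda>x. indicator {0..1} (x p) * F x) \<in> borel_measurable (leb V)"
    using F_measurable borel_measurable_pin[OF V(2)] by (rule borel_measurable_times_ennreal[rotated])
  from nn_integral_leb_reindex[OF V(1,1) bij_s this] show ?thesis
    using V(2) by (simp add: pinned_integral_def)
qed

lemma nn_integral_upd_translation_invariant:
  assumes W: "finite W" "p \<notin> W" and F_measurable[measurable]: "F \<in> borel_measurable (leb (insert p W))"
    and invariant: "translation_invariant (insert p W) F"
  shows "(\<integral>\<^sup>+ x. F (x(p := y)) \<partial>leb W) = (\<integral>\<^sup>+ x. F (x(p := 0)) \<partial>leb W)"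
proof -
  have "(\<lambda>x. F (x(p := y))) \<in> borel_measurable (leb W)"
    by (rule measurable_compose[OF _ F_measurable]) (use W in measurable)
  from nn_integral_leb_shift[OF W(1) this, of y]
  have "(\<integral>\<^sup>+ x. F (x(p := y)) \<partial>leb W) = (\<integral>\<^sup>+ x. F ((\<lambda>v\<in>W. x v + y)(p := y)) \<partial>leb W)" ..
  also have "\<dots> = (\<integral>\<^sup>+ x. F (x(p := 0)) \<partial>leb W)"
  proof (rule nn_integral_cong)
    fix x
    have "(\<lambda>v\<in>W. x v + y)(p := y) = (\<lambda>v\<in>insert p W. (x(p := 0)) v + y)"
      using W(2) by (auto simp: fun_eq_iff)
    then show "F ((\<lambda>v\<in>W. x v + y)(p := y)) = F (x(p := 0))"
      using invariant by (simp only: translation_invariant_def)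
  qed
  finally show ?thesis .
qed

lemma nn_integral_pinned_at_0:
  assumes V: "finite V" "p \<in> V" and F_measurable: "F \<in> borel_measurable (leb V)" and invariant: "translation_invariant V F"
  shows "(\<integral>\<^sup>+ x. F x \<partial>PiM V (\<lambda>v. if v = p then return lborel 0 else lborel)) = pinned_integral V p F"
proof -
  let ?M = "\<lambda>v. if v = p then return lborel 0 else lborel :: real measure"
  define W where "W = V - {p}"
  have W: "finite W" "p \<notin> W" and V_eq: "V = insert p W" using V by (auto simp: W_def)
  note F_measurable[unfolded V_eq, measurable] and upd = nn_integral_upd_translation_invariant[OF W F_measurable[unfolded V_eq] invariant[unfolded V_eq]]
  interpret R: product_sigma_finite ?M
    using prob_space_return[of 0 "lborel :: real measure"] sigma_finite_lborel
    by (intro product_sigma_finite.intro) (auto intro: prob_space_imp_sigma_finite)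
  have PiM_W: "PiM W ?M = leb W" by (rule PiM_cong) (use W in auto)
  have "sets (PiM V ?M) = sets (leb V)" by (rule sets_PiM_cong) auto
  then have F_measurable': "F \<in> borel_measurable (PiM (insert p W) ?M)"
    using F_measurable unfolding V_eq by (simp cong: measurable_cong_sets)
  let ?J = "\<integral>\<^sup>+ x. F (x(p := 0)) \<partial>leb W"
  have "(\<integral>\<^sup>+ x. F x \<partial>PiM V ?M) = (\<integral>\<^sup>+ y. (\<integral>\<^sup>+ x. F (x(p := y)) \<partial>leb W) \<partial>return lborel 0)"
    unfolding V_eq by (subst R.product_nn_integral_insert_rev[OF W F_measurable']) (simp add: PiM_W)
  also have "\<dots> = ?J"
    by (subst upd) (use prob_space.emeasure_space_1[OF prob_space_return[of 0 "lborel :: real measure"]] in simp)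
  also have "\<dots> = (\<integral>\<^sup>+ y. indicator {0..1::real} y * ?J \<partial>lborel)"
    by (simp add: nn_integral_multc)
  also have "\<dots> = (\<integral>\<^sup>+ y. (\<integral>\<^sup>+ x. indicator {0..1} ((x(p := y)) p) * F (x(p := y)) \<partial>leb W) \<partial>lborel)"
  proof (rule nn_integral_cong)
    fix y :: real
    have "(\<lambda>x. F (x(p := y))) \<in> borel_measurable (leb W)"
      by (rule measurable_compose[OF _ F_measurable[unfolded V_eq]]) (use W in measurable)
    then show "indicator {0..1} y * ?J = (\<integral>\<^sup>+ x. indicator {0..1} ((x(p := y)) p) * F (x(p := y)) \<partial>leb W)"
      by (simp add: nn_integral_cmult upd[of y])
  qed
  also have "\<dots> = pinned_integral V p F"
    unfolding pinned_integral_def V_eq by (rule leb.product_nn_integral_insert_rev[OF W, symmetric]) measurable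
  finally show ?thesis .
qed

definition edge_prod :: "('v \<times> 'v) set \<Rightarrow> ('v \<times> 'v \<Rightarrow> real \<Rightarrow> ennreal) \<Rightarrow> ('v \<Rightarrow> real) \<Rightarrow> ennreal" where
  "edge_prod D f x = (\<Prod>e\<in>D. f e (x (fst e) - x (snd e)))"

lemma borel_measurable_gradient:
  assumes "u \<in> V" "v \<in> V" and [measurable]: "g \<in> borel_measurable borel"
  shows "(\<lambda>x. g (x u - x v)) \<in> borel_measurable (leb V)"
  using assms(1,2)[measurable] by measurable

lemma edge_prod_measurable:
  assumes "D \<subseteq> V \<times> V" "\<And>e. e \<in> D \<Longrightarrow> f e \<in> borel_measurable borel"
  shows "edge_prod D f \<in> borel_measurable (leb V)"
  unfolding edge_prod_def[abs_def] using assms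
  by (intro borel_measurable_prod_ennreal borel_measurable_gradient) auto

lemma edge_prod_cong:
  assumes "\<And>e. e \<in> D \<Longrightarrow> f e = g e" "\<And>e. e \<in> D \<Longrightarrow> x (fst e) - x (snd e) = y (fst e) - y (snd e)"
  shows "edge_prod D f x = edge_prod D g y"
  unfolding edge_prod_def using assms by (intro prod.cong) auto

lemma edge_prod_translation_invariant:
  "D \<subseteq> V \<times> V \<Longrightarrow> translation_invariant V (edge_prod D f)"
  unfolding translation_invariant_def by (intro allI edge_prod_cong) auto

lemma edge_prod_Un_disjoint:
  "finite D \<Longrightarrow> finite E \<Longrightarrow> D \<inter> E = {} \<Longrightarrow> edge_prod (D \<union> E) f x = edge_prod D f x * edge_prod E f x"
  unfolding edge_prod_def by (rule prod.union_disjoint)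

lemma edge_prod_mono:
  "(\<And>e y. e \<in> D \<Longrightarrow> f e y \<le> g e y) \<Longrightarrow> edge_prod D f x \<le> edge_prod D g x"
  unfolding edge_prod_def by (rule prod_mono_ennreal)

section \<open>Reflection positivity\<close>

locale reflection =
  fixes V0 A B :: "'v set" and r :: "'v \<Rightarrow> 'v"
  assumes finite: "finite V0" "finite A" "finite B"
    and disjoint: "V0 \<inter> A = {}" "V0 \<inter> B = {}" "A \<inter> B = {}"
    and refl_axis: "v \<in> V0 \<Longrightarrow> r v = v"
    and refl_halves: "v \<in> A \<Longrightarrow> r v \<in> B" "v \<in> B \<Longrightarrow> r v \<in> A"
    and refl_refl: "v \<in> V0 \<union> (A \<union> B) \<Longrightarrow> r (r v) = v"
begin

abbreviation V :: "'v set" where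
  "V \<equiv> V0 \<union> (A \<union> B)"

lemma disjointD: "v \<in> V0 \<Longrightarrow> v \<notin> A" "v \<in> V0 \<Longrightarrow> v \<notin> B" "v \<in> A \<Longrightarrow> v \<notin> B"
  using disjoint by blast+

lemma bij_betw_refl: "bij_betw r A B"
  by (rule bij_betw_byWitness[where f' = r]) (use refl_halves refl_refl in auto)

definition half_integral :: "(('v \<Rightarrow> real) \<Rightarrow> ennreal) \<Rightarrow> ('v \<Rightarrow> real) \<Rightarrow> ennreal" where
  "half_integral H x = (\<integral>\<^sup>+ y. H (merge V0 A (x, y)) \<partial>leb A)"

definition reflection_form ::
    "(('v \<Rightarrow> real) \<Rightarrow> ennreal) \<Rightarrow> (('v \<Rightarrow> real) \<Rightarrow> ennreal) \<Rightarrow> (('v \<Rightarrow> real) \<Rightarrow> ennreal) \<Rightarrow> ennreal" where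
  "reflection_form W H K = (\<integral>\<^sup>+ x. W (restrict x V0) *
     (H (restrict x (V0 \<union> A)) * K (\<lambda>v\<in>V0 \<union> A. x (r v))) \<partial>leb V)"

lemma measurable_half_integral:
  assumes [measurable]: "H \<in> borel_measurable (leb (V0 \<union> A))"
  shows "half_integral H \<in> borel_measurable (leb V0)"
proof -
  interpret A: sigma_finite_measure "leb A" by (rule leb.sigma_finite[OF finite(2)])
  show ?thesis unfolding half_integral_def[abs_def] by measurable
qed

lemma measurable_merge_half:
  "H \<in> borel_measurable (leb (V0 \<union> A)) \<Longrightarrow> x \<in> space (leb V0) \<Longrightarrow>
    (\<lambda>y. H (merge V0 A (x, y))) \<in> borel_measurable (leb A)"
  by (rule measurable_compose[where g = H and N = "leb (V0 \<union> A)"]) (measurable, simp)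

lemma half_integral_reflected:
  assumes "H \<in> borel_measurable (leb (V0 \<union> A))" "x \<in> space (leb V0)"
  shows "(\<lambda>z. H (merge V0 A (x, \<lambda>v\<in>A. z (r v)))) \<in> borel_measurable (leb B)"
    and "(\<integral>\<^sup>+ z. H (merge V0 A (x, \<lambda>v\<in>A. z (r v))) \<partial>leb B) = half_integral H x"
proof -
  note half = measurable_merge_half[OF assms]
  have "(\<lambda>z. \<lambda>v\<in>A. z (r v)) \<in> measurable (leb B) (leb A)"
    using refl_halves(1) by (intro measurable_restrict measurable_component_singleton)
  then show "(\<lambda>z. H (merge V0 A (x, \<lambda>v\<in>A. z (r v)))) \<in> borel_measurable (leb B)"
    by (rule measurable_compose[OF _ half])
  show "(\<integral>\<^sup>+ z. H (merge V0 A (x, \<lambda>v\<in>A. z (r v))) \<partial>leb B) = half_integral H x"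
    using nn_integral_leb_reindex[OF finite(2,3) bij_betw_refl half] by (simp add: half_integral_def)
qed

lemma merge_halves:
  fixes x y z
  assumes "x \<in> space (leb V0)"
  defines "m \<equiv> merge V0 (A \<union> B) (x, merge A B (y, z))"
  shows "restrict m V0 = x" "restrict m (V0 \<union> A) = merge V0 A (x, y)"
    "(\<lambda>v\<in>V0 \<union> A. m (r v)) = merge V0 A (x, \<lambda>v\<in>A. z (r v))"
proof -
  show "restrict m V0 = x"
    using assms disjoint by (simp add: space_PiM PiE_restrict Int_Un_distrib)
  show "restrict m (V0 \<union> A) = merge V0 A (x, y)"
    using disjoint by (auto simp: m_def fun_eq_iff merge_def)
  show "(\<lambda>v\<in>V0 \<union> A. m (r v)) = merge V0 A (x, \<lambda>v\<in>A. z (r v))"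
    using disjoint refl_axis refl_halves(1) by (fastforce simp: m_def fun_eq_iff merge_def)
qed

lemma measurable_mirror: "(\<lambda>x. \<lambda>v\<in>V0 \<union> A. x (r v)) \<in> measurable (leb V) (leb (V0 \<union> A))"
proof (intro measurable_restrict)
  fix v assume "v \<in> V0 \<union> A"
  then have "r v \<in> V" using refl_axis[of v] refl_halves(1)[of v] by auto
  then show "(\<lambda>x. x (r v)) \<in> measurable (leb V) lborel" by (rule measurable_component_singleton)
qed

lemma reflection_form_eq:
  assumes W_measurable: "W \<in> borel_measurable (leb V0)"
    and H_measurable: "H \<in> borel_measurable (leb (V0 \<union> A))" and K_measurable: "K \<in> borel_measurable (leb (V0 \<union> A))"
  shows "reflection_form W H K = (\<integral>\<^sup>+ x. W x * (half_integral H x * half_integral K x) \<partial>leb V0)"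
proof -
  let ?F = "\<lambda>x. W (restrict x V0) * (H (restrict x (V0 \<union> A)) * K (\<lambda>v\<in>V0 \<union> A. x (r v)))"
  have F_measurable: "?F \<in> borel_measurable (leb V)"
    by (intro borel_measurable_times_ennreal measurable_compose[OF _ W_measurable] measurable_compose[OF _ H_measurable]
        measurable_compose[OF measurable_mirror K_measurable] measurable_restrict_subset) auto
  have inner_integral: "(\<integral>\<^sup>+ u. ?F (merge V0 (A \<union> B) (x, u)) \<partial>leb (A \<union> B)) = W x * (half_integral H x * half_integral K x)"
    if x_space: "x \<in> space (leb V0)" for x
  proof -
    have "(\<lambda>u. ?F (merge V0 (A \<union> B) (x, u))) \<in> borel_measurable (leb (A \<union> B))"
      using x_space by (intro measurable_compose[OF _ F_measurable]) measurable
    then have "(\<integral>\<^sup>+ u. ?F (merge V0 (A \<union> B) (x, u)) \<partial>leb (A \<union> B))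
        = (\<integral>\<^sup>+ y. (\<integral>\<^sup>+ z. ?F (merge V0 (A \<union> B) (x, merge A B (y, z))) \<partial>leb B) \<partial>leb A)"
      by (rule leb.product_nn_integral_fold[OF disjoint(3) finite(2,3)])
    also have "\<dots> = W x * (half_integral H x * half_integral K x)"
      unfolding merge_halves[OF x_space] using measurable_merge_half[OF H_measurable x_space] half_integral_reflected[OF K_measurable x_space]
      by (simp add: nn_integral_cmult nn_integral_multc) (simp add: half_integral_def)
    finally show ?thesis .
  qed
  have "reflection_form W H K = (\<integral>\<^sup>+ x. (\<integral>\<^sup>+ u. ?F (merge V0 (A \<union> B) (x, u)) \<partial>leb (A \<union> B)) \<partial>leb V0)"
    unfolding reflection_form_def using disjoint finite F_measurable by (intro leb.product_nn_integral_fold) auto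
  then show ?thesis by (simp add: inner_integral cong: nn_integral_cong)
qed

lemma reflection_form_Cauchy_Schwarz:
  assumes W_measurable[measurable]: "W \<in> borel_measurable (leb V0)"
    and H_measurable: "H \<in> borel_measurable (leb (V0 \<union> A))" and K_measurable: "K \<in> borel_measurable (leb (V0 \<union> A))"
  shows "(reflection_form W H K)\<^sup>2 \<le> reflection_form W H H * reflection_form W K K"
proof -
  note [measurable] = measurable_half_integral[OF H_measurable] measurable_half_integral[OF K_measurable]
  have "(\<integral>\<^sup>+ x. half_integral H x * half_integral K x \<partial>density (leb V0) W)\<^sup>2
    \<le> (\<integral>\<^sup>+ x. (half_integral H x)\<^sup>2 \<partial>density (leb V0) W) * (\<integral>\<^sup>+ x. (half_integral K x)\<^sup>2 \<partial>density (leb V0) W)"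
    by (rule Cauchy_Schwarz_nn_integral) simp_all
  then show ?thesis
    by (simp add: reflection_form_eq W_measurable H_measurable K_measurable nn_integral_density power2_eq_square)
qed

end

definition reflect_edges :: "('v \<Rightarrow> 'v) \<Rightarrow> 'v set \<Rightarrow> ('v \<times> 'v \<Rightarrow> 'c) \<Rightarrow> 'v \<times> 'v \<Rightarrow> 'c" where
  "reflect_edges r S f e = (if fst e \<in> S \<or> snd e \<in> S then f (map_prod r r e) else f e)"

locale reflection_graph = reflection V0 A B r for V0 A B :: "'v set" and r +
  fixes D :: "('v \<times> 'v) set"
  assumes edges_subset: "D \<subseteq> V \<times> V"
    and no_crossing: "(v, w) \<in> D \<Longrightarrow> v \<in> A \<Longrightarrow> w \<notin> B" "(v, w) \<in> D \<Longrightarrow> v \<in> B \<Longrightarrow> w \<notin> A"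
    and edges_refl: "(v, w) \<in> D \<Longrightarrow> (r v, r w) \<in> D"
begin

definition axis_edges :: "('v \<times> 'v) set" where
  "axis_edges = D \<inter> V0 \<times> V0"

definition edges_A :: "('v \<times> 'v) set" where
  "edges_A = {e \<in> D. fst e \<in> A \<or> snd e \<in> A}"

definition edges_B :: "('v \<times> 'v) set" where
  "edges_B = {e \<in> D. fst e \<in> B \<or> snd e \<in> B}"

lemma edge_classes:
  "D = axis_edges \<union> (edges_A \<union> edges_B)" "axis_edges \<inter> (edges_A \<union> edges_B) = {}" "edges_A \<inter> edges_B = {}"
  "axis_edges \<subseteq> V0 \<times> V0" "edges_A \<subseteq> (V0 \<union> A) \<times> (V0 \<union> A)" "edges_B \<subseteq> (V0 \<union> B) \<times> (V0 \<union> B)"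
  unfolding axis_edges_def edges_A_def edges_B_def using edges_subset no_crossing by (auto dest: disjointD)

lemma finite_edge_classes: "finite axis_edges" "finite edges_A" "finite edges_B"
  using edge_classes(4-6) finite by (auto intro: finite_subset)

lemma refl_edge: "e \<in> D \<Longrightarrow> map_prod r r e \<in> D"
  using edges_refl by (cases e) simp

lemma refl_refl_edge: "e \<in> D \<Longrightarrow> map_prod r r (map_prod r r e) = e"
  using edges_subset by (cases e) (auto simp: refl_refl)

lemma bij_betw_refl_edges: "bij_betw (map_prod r r) edges_A edges_B"
  by (rule bij_betw_byWitness[where f' = "map_prod r r"])
    (use refl_edge refl_refl_edge refl_halves in \<open>auto simp: edges_A_def edges_B_def\<close>)

lemma edge_prod_reflected:
  "edge_prod edges_B f x = edge_prod edges_A (\<lambda>e. f (map_prod r r e)) (\<lambda>v\<in>V0 \<union> A. x (r v))"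
proof -
  have "edge_prod edges_B f x = (\<Prod>e\<in>edges_A. f (map_prod r r e) (x (r (fst e)) - x (r (snd e))))"
    unfolding edge_prod_def by (subst prod.reindex_bij_betw[OF bij_betw_refl_edges, symmetric]) simp
  also have "\<dots> = edge_prod edges_A (\<lambda>e. f (map_prod r r e)) (\<lambda>v\<in>V0 \<union> A. x (r v))"
    unfolding edge_prod_def using edge_classes(5) by (intro prod.cong) auto
  finally show ?thesis .
qed

definition axis_weight :: "'v \<Rightarrow> ('v \<times> 'v \<Rightarrow> real \<Rightarrow> ennreal) \<Rightarrow> ('v \<Rightarrow> real) \<Rightarrow> ennreal" where
  "axis_weight p f x = indicator {0..1} (x p) * edge_prod axis_edges f x"

lemma pinned_integral_eq_reflection_form:
  assumes p_axis: "p \<in> V0"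
  shows "pinned_integral V p (edge_prod D f)
    = reflection_form (axis_weight p f) (edge_prod edges_A f) (edge_prod edges_A (\<lambda>e. f (map_prod r r e)))"
  unfolding pinned_integral_def reflection_form_def
proof (rule nn_integral_cong)
  fix x :: "'v \<Rightarrow> real"
  have "edge_prod D f x = edge_prod axis_edges f x * (edge_prod edges_A f x * edge_prod edges_B f x)"
    using edge_classes(2,3) finite_edge_classes by (subst edge_classes(1)) (simp add: edge_prod_Un_disjoint)
  moreover have "edge_prod axis_edges f x = edge_prod axis_edges f (restrict x V0)"
    using edge_classes(4) by (intro edge_prod_cong) auto
  moreover have "edge_prod edges_A f x = edge_prod edges_A f (restrict x (V0 \<union> A))"
    using edge_classes(5) by (intro edge_prod_cong refl) auto
  ultimately show "indicator {0..1} (x p) * edge_prod D f x = axis_weight p f (restrict x V0) *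
      (edge_prod edges_A f (restrict x (V0 \<union> A)) * edge_prod edges_A (\<lambda>e. f (map_prod r r e)) (\<lambda>v\<in>V0 \<union> A. x (r v)))"
    using p_axis by (simp add: axis_weight_def edge_prod_reflected mult.assoc)
qed

lemma reflection_positivity:
  assumes p_axis: "p \<in> V0" and f_measurable: "\<And>e. e \<in> D \<Longrightarrow> f e \<in> borel_measurable borel"
  shows "(pinned_integral V p (edge_prod D f))\<^sup>2
    \<le> pinned_integral V p (edge_prod D (reflect_edges r B f)) * pinned_integral V p (edge_prod D (reflect_edges r A f))"
proof -
  let ?W = "axis_weight p f" and ?H = "edge_prod edges_A f" and ?K = "edge_prod edges_A (\<lambda>e. f (map_prod r r e))"
  have axis_edges_avoid: "fst e \<notin> A \<union> B" "snd e \<notin> A \<union> B" if "e \<in> axis_edges" for e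
    using subsetD[OF edge_classes(4) that] by (auto dest: disjointD)
  have edges_A_touch: "fst e \<notin> B" "snd e \<notin> B" "fst e \<in> A \<or> snd e \<in> A" if "e \<in> edges_A" for e
    using that subsetD[OF edge_classes(5) that] by (auto simp: edges_A_def dest: disjointD)
  have edges_B_touch: "fst e \<notin> A" "snd e \<notin> A" "fst e \<in> B \<or> snd e \<in> B" if "e \<in> edges_B" for e
    using that subsetD[OF edge_classes(6) that] by (auto simp: edges_B_def dest: disjointD)
  have refl_edges_A: "map_prod r r e \<in> edges_B" if "e \<in> edges_A" for e
    using that bij_betw_refl_edges by (auto dest: bij_betw_apply)
  have [simp]: "axis_weight p (reflect_edges r B f) = ?W" "axis_weight p (reflect_edges r A f) = ?W"
    unfolding axis_weight_def using axis_edges_avoid by (auto simp: reflect_edges_def intro!: ext edge_prod_cong arg_cong2[where f = "(*)"])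
  have [simp]: "edge_prod edges_A (reflect_edges r B f) = ?H" "edge_prod edges_A (reflect_edges r A f) = ?K"
    using edges_A_touch by (auto simp: reflect_edges_def intro!: ext edge_prod_cong)
  have "reflect_edges r B f (map_prod r r e) = f e" "reflect_edges r A f (map_prod r r e) = f (map_prod r r e)"
    if "e \<in> edges_A" for e
    using edges_B_touch[OF refl_edges_A[OF that]] refl_refl_edge[of e] that by (auto simp: reflect_edges_def edges_A_def)
  then have [simp]: "edge_prod edges_A (\<lambda>e. reflect_edges r B f (map_prod r r e)) = ?H"
    "edge_prod edges_A (\<lambda>e. reflect_edges r A f (map_prod r r e)) = ?K"
    by (intro ext edge_prod_cong; simp)+
  have "(reflection_form ?W ?H ?K)\<^sup>2 \<le> reflection_form ?W ?H ?H * reflection_form ?W ?K ?K"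
  proof (rule reflection_form_Cauchy_Schwarz)
    show "?W \<in> borel_measurable (leb V0)"
      unfolding axis_weight_def[abs_def] using p_axis f_measurable edge_classes
      by (intro borel_measurable_times_ennreal edge_prod_measurable borel_measurable_pin) auto
    show "?H \<in> borel_measurable (leb (V0 \<union> A))" "?K \<in> borel_measurable (leb (V0 \<union> A))"
      using f_measurable refl_edge edge_classes(5) by (auto intro!: edge_prod_measurable simp: edges_A_def)
  qed
  then show ?thesis by (simp add: pinned_integral_eq_reflection_form[OF p_axis])
qed

end

section \<open>Integration along a rooted tree\<close>

lemma nn_integral_lborel_shift:
  fixes g :: "real \<Rightarrow> ennreal"
  assumes "g \<in> borel_measurable borel"
  shows "(\<integral>\<^sup>+ y. g (y - c) \<partial>lborel) = (\<integral>\<^sup>+ y. g y \<partial>lborel)"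
  using nn_integral_real_affine[OF assms, of 1 "- c"] by simp

lemma nn_integral_leaf:
  assumes W: "finite W" "v \<notin> W" "u \<in> W"
    and F: "F \<in> borel_measurable (leb W)" and h_measurable: "h \<in> borel_measurable borel"
  shows "(\<integral>\<^sup>+ x. F (restrict x W) * h (x v - x u) \<partial>leb (insert v W)) = (\<integral>\<^sup>+ x. F x \<partial>leb W) * (\<integral>\<^sup>+ y. h y \<partial>lborel)"
proof -
  have "(\<lambda>x. F (restrict x W) * h (x v - x u)) \<in> borel_measurable (leb (insert v W))"
    using W(3) by (intro borel_measurable_times_ennreal borel_measurable_gradient h_measurable
        measurable_compose[OF _ F] measurable_restrict_subset) auto
  then have "(\<integral>\<^sup>+ x. F (restrict x W) * h (x v - x u) \<partial>leb (insert v W))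
      = (\<integral>\<^sup>+ x. (\<integral>\<^sup>+ y. F (restrict (x(v := y)) W) * h ((x(v := y)) v - (x(v := y)) u) \<partial>lborel) \<partial>leb W)"
    by (rule leb.product_nn_integral_insert[OF W(1,2)])
  also have "\<dots> = (\<integral>\<^sup>+ x. F x * (\<integral>\<^sup>+ y. h y \<partial>lborel) \<partial>leb W)"
  proof (rule nn_integral_cong)
    fix x :: "'a \<Rightarrow> real" assume "x \<in> space (leb W)"
    then have "restrict (x(v := y)) W = x" for y using W(2) by (auto simp: space_PiM PiE_iff extensional_def fun_eq_iff)
    moreover have "(x(v := y)) v - (x(v := y)) u = y - x u" for y using W by auto
    ultimately show "(\<integral>\<^sup>+ y. F (restrict (x(v := y)) W) * h ((x(v := y)) v - (x(v := y)) u) \<partial>lborel)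
        = F x * (\<integral>\<^sup>+ y. h y \<partial>lborel)"
      using h_measurable by (simp add: nn_integral_cmult nn_integral_lborel_shift del: fun_upd_apply)
  qed
  also have "\<dots> = (\<integral>\<^sup>+ x. F x \<partial>leb W) * (\<integral>\<^sup>+ y. h y \<partial>lborel)"
    by (rule nn_integral_multc[OF F])
  finally show ?thesis .
qed

lemma pinned_integral_leaf:
  assumes W: "finite W" "v \<notin> W" "u \<in> W" "p \<in> W" and F: "F \<in> borel_measurable (leb W)" "\<And>x. F (restrict x W) = F x"
    and h_measurable: "h \<in> borel_measurable borel"
  shows "pinned_integral (insert v W) p (\<lambda>x. F x * h (x v - x u)) = pinned_integral W p F * (\<integral>\<^sup>+ y. h y \<partial>lborel)"
proof -
  have "(\<lambda>x. indicator {0..1} (x p) * F x) \<in> borel_measurable (leb W)"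
    by (intro borel_measurable_times_ennreal borel_measurable_pin W F)
  from nn_integral_leaf[OF W(1-3) this h_measurable] show ?thesis
    using W(4) by (simp add: pinned_integral_def F(2) mult.assoc)
qed

lemma pinned_integral_tree:
  fixes height :: "'v \<Rightarrow> nat" and parent :: "'v \<Rightarrow> 'v" and h :: "'v \<Rightarrow> real \<Rightarrow> ennreal"
  assumes "finite W" "base \<notin> W" "\<And>v. v \<in> W \<Longrightarrow> parent v \<in> insert base W \<and> height (parent v) < height v"
    and h_measurable: "\<And>v. h v \<in> borel_measurable borel"
  shows "pinned_integral (insert base W) base (\<lambda>x. \<Prod>v\<in>W. h v (x v - x (parent v))) = (\<Prod>v\<in>W. \<integral>\<^sup>+ y. h v y \<partial>lborel)"
  using assms(1-3)
proof (induction W rule: finite_ranking_induct[where f = height])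
  case empty
  then show ?case
    using leb.product_nn_integral_singleton[of "indicator {0..1::real}" base] by (simp add: pinned_integral_def)
next
  case (insert v W)
  show ?case
  proof (cases "v \<in> W")
    case True
    then show ?thesis using insert.IH insert.prems by (simp add: insert_absorb)
  next
    case False
    let ?V = "insert base W" and ?F = "\<lambda>x. \<Prod>w\<in>W. h w (x w - x (parent w))"
    have parent: "parent w \<in> ?V \<and> height (parent w) < height w" if "w \<in> W" for w
      using insert.prems(2)[of w] insert.hyps(2)[OF that] that by fastforce
    have parent_v: "parent v \<in> ?V" using insert.prems(2)[of v] by auto
    have F: "?F \<in> borel_measurable (leb ?V)"
      using parent by (intro borel_measurable_prod_ennreal borel_measurable_gradient h_measurable) auto
    have F_restrict: "?F (restrict x ?V) = ?F x" for x
      using parent by (intro prod.cong) auto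
    have "pinned_integral (insert base (insert v W)) base (\<lambda>x. \<Prod>w\<in>insert v W. h w (x w - x (parent w)))
        = pinned_integral (insert v ?V) base (\<lambda>x. ?F x * h v (x v - x (parent v)))"
      using insert.hyps(1) False by (simp add: insert_commute mult.commute)
    also have "\<dots> = pinned_integral ?V base ?F * (\<integral>\<^sup>+ y. h v y \<partial>lborel)"
      using insert.hyps(1) insert.prems(1) False parent_v
      by (intro pinned_integral_leaf F F_restrict h_measurable) auto
    also have "pinned_integral ?V base ?F = (\<Prod>w\<in>W. \<integral>\<^sup>+ y. h w y \<partial>lborel)"
      using insert.IH parent insert.prems(1) by simp
    finally show ?thesis using insert.hyps(1) False by (simp add: mult.commute)
  qed
qed

lemma edge_prod_le_power:
  assumes "\<And>e y. f e y \<le> ennreal Q" "1 \<le> Q" "finite D" "R \<subseteq> D"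
  shows "edge_prod R f x \<le> ennreal (Q ^ card D)"
proof -
  have "edge_prod R f x \<le> (\<Prod>e\<in>R. ennreal Q)"
    unfolding edge_prod_def by (intro prod_mono_ennreal assms(1))
  also have "\<dots> = ennreal (Q ^ card R)" using assms(2) by (simp add: ennreal_power)
  also have "\<dots> \<le> ennreal (Q ^ card D)"
    using assms by (intro ennreal_leI power_increasing card_mono) auto
  finally show ?thesis .
qed

lemma edge_prod_spanning_tree_le:
  fixes height :: "'v \<Rightarrow> nat" and parent :: "'v \<Rightarrow> 'v" and f :: "'v \<times> 'v \<Rightarrow> real \<Rightarrow> ennreal" and Q :: real
  assumes W: "finite W" and height: "\<And>v. v \<in> W \<Longrightarrow> height (parent v) < height v"
    and D: "finite D" "\<And>v. v \<in> W \<Longrightarrow> (v, parent v) \<in> D \<and> (parent v, v) \<in> D"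
    and f: "\<And>e y. f e y \<le> ennreal Q" and Q: "1 \<le> Q"
  shows "edge_prod D f x \<le> ennreal (Q ^ card D) *
    (\<Prod>v\<in>W. f (v, parent v) (x v - x (parent v)) * f (parent v, v) (- (x v - x (parent v))))"
proof -
  define down up where "down = (\<lambda>v. (v, parent v)) ` W" and "up = (\<lambda>v. (parent v, v)) ` W"
  define R where "R = D - (down \<union> up)"
  have D_eq: "D = (down \<union> up) \<union> R" and fin: "finite down" "finite up" "finite R"
    using D W by (auto simp: down_def up_def R_def)
  have "parent (parent v) \<noteq> v" if "v \<in> W" "parent v \<in> W" for v
    using height[OF that(1)] height[OF that(2)] by auto
  then have disj: "down \<inter> up = {}" "(down \<union> up) \<inter> R = {}"
    by (auto simp: down_def up_def R_def)
  have "edge_prod D f x = edge_prod R f x * (edge_prod down f x * edge_prod up f x)"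
    using fin disj by (subst D_eq) (simp add: edge_prod_Un_disjoint mult.commute)
  also have "\<dots> \<le> ennreal (Q ^ card D) * (edge_prod down f x * edge_prod up f x)"
    using edge_prod_le_power[OF f Q D(1), where R = R and x = x] by (intro mult_right_mono) (auto simp: R_def)
  also have "edge_prod down f x * edge_prod up f x
      = (\<Prod>v\<in>W. f (v, parent v) (x v - x (parent v)) * f (parent v, v) (- (x v - x (parent v))))"
    by (simp add: edge_prod_def down_def up_def prod.reindex inj_on_def prod.distrib)
  finally show ?thesis .
qed

lemma pinned_integral_spanning_tree_le:
  fixes height :: "'v \<Rightarrow> nat" and parent :: "'v \<Rightarrow> 'v" and f :: "'v \<times> 'v \<Rightarrow> real \<Rightarrow> ennreal" and Q :: real
  assumes W: "finite W" "base \<notin> W"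
    and parent: "\<And>v. v \<in> W \<Longrightarrow> parent v \<in> insert base W \<and> height (parent v) < height v"
    and D: "finite D" "\<And>v. v \<in> W \<Longrightarrow> (v, parent v) \<in> D \<and> (parent v, v) \<in> D"
    and f: "\<And>e. f e \<in> borel_measurable borel" "\<And>e y. f e y \<le> ennreal Q" and Q: "1 \<le> Q"
  shows "pinned_integral (insert base W) base (edge_prod D f)
    \<le> ennreal (Q ^ card D) * (\<Prod>v\<in>W. \<integral>\<^sup>+ y. f (v, parent v) y * f (parent v, v) (- y) \<partial>lborel)"
proof -
  define h where "h = (\<lambda>v y. f (v, parent v) y * f (parent v, v) (- y))"
  let ?T = "\<lambda>x. \<Prod>v\<in>W. h v (x v - x (parent v))"
  have h_measurable: "h v \<in> borel_measurable borel" for v unfolding h_def using f(1) by measurable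
  have "pinned_integral (insert base W) base (edge_prod D f)
      \<le> pinned_integral (insert base W) base (\<lambda>x. ennreal (Q ^ card D) * ?T x)"
    unfolding h_def using parent by (intro pinned_integral_mono edge_prod_spanning_tree_le[where height = height] W(1) D f(2) Q) auto
  also have "\<dots> = ennreal (Q ^ card D) * pinned_integral (insert base W) base ?T"
    unfolding pinned_integral_def mult.left_commute[of "indicator _ _"] using parent
    by (intro nn_integral_cmult borel_measurable_times_ennreal borel_measurable_pin
        borel_measurable_prod_ennreal borel_measurable_gradient h_measurable) auto
  also have "pinned_integral (insert base W) base ?T = (\<Prod>v\<in>W. \<integral>\<^sup>+ y. h v y \<partial>lborel)"
    using W parent h_measurable by (rule pinned_integral_tree)
  finally show ?thesis by (simp add: h_def)
qed

section \<open>Placing heights greedily\<close>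

lemma emeasure_Collect_avoiding:
  fixes a \<eta> :: real and c :: "'e \<Rightarrow> real"
  assumes G: "G \<in> sets borel" and bad_le: "emeasure lborel ({-a..a} - G) \<le> ennreal \<eta>" and \<eta>: "0 \<le> \<eta>"
    and E: "finite E" "card E \<le> k" "real k * \<eta> \<le> a / 2" and a_pos: "0 < a"
    and c_range: "\<And>e. e \<in> E \<Longrightarrow> c e \<in> {0..a}"
  shows "ennreal (a / 2) \<le> emeasure lborel {y \<in> {0..a}. \<forall>e\<in>E. y - c e \<in> G}"
proof -
  define Good where "Good = {y \<in> {0..a}. \<forall>e\<in>E. y - c e \<in> G}"
  define Bad where "Bad = (\<lambda>e. (\<lambda>y. y - c e) -` ({-a..a} - G))"
  note [measurable] = G
  have Good_sets: "Good \<in> sets lborel" unfolding Good_def using E(1) by measurable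
  have Bad: "Bad e \<in> sets lborel" "emeasure lborel (Bad e) \<le> ennreal \<eta>" for e
    using emeasure_lborel_vimage_shift[of "{-a..a} - G" "- c e"] G bad_le by (simp_all add: Bad_def)
  have "{0..a} \<subseteq> Good \<union> (\<Union>e\<in>E. Bad e)" using c_range by (force simp: Good_def Bad_def)
  then have "emeasure lborel {0..a} \<le> emeasure lborel (Good \<union> (\<Union>e\<in>E. Bad e))"
    using E(1) Good_sets Bad(1) by (intro emeasure_mono) auto
  also have "\<dots> \<le> emeasure lborel Good + (\<Sum>e\<in>E. emeasure lborel (Bad e))"
    using E(1) Good_sets Bad(1)
    by (intro order_trans[OF emeasure_subadditive] add_left_mono emeasure_subadditive_finite) auto
  also have "\<dots> \<le> emeasure lborel Good + ennreal (a / 2)"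
  proof (rule add_left_mono)
    have "(\<Sum>e\<in>E. emeasure lborel (Bad e)) \<le> (\<Sum>e\<in>E. ennreal \<eta>)" by (intro sum_mono Bad(2))
    also have "\<dots> = ennreal (real (card E) * \<eta>)" using \<eta> by (simp add: ennreal_mult ennreal_of_nat_eq_real_of_nat)
    also have "\<dots> \<le> ennreal (a / 2)"
      using E(2,3) \<eta> by (intro ennreal_leI order_trans[OF _ E(3)] mult_right_mono) auto
    finally show "(\<Sum>e\<in>E. emeasure lborel (Bad e)) \<le> ennreal (a / 2)" .
  qed
  finally have "ennreal (a / 2) + ennreal (a / 2) \<le> ennreal (a / 2) + emeasure lborel Good"
    using a_pos by (simp add: add.commute flip: ennreal_plus)
  then show ?thesis by (simp only: ennreal_add_left_cancel_le Good_def) simp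
qed

definition good_heights :: "real \<Rightarrow> real set \<Rightarrow> ('v \<times> 'v) set \<Rightarrow> 'v set \<Rightarrow> ('v \<Rightarrow> real) set" where
  "good_heights a G D V = {x \<in> space (leb V). (\<forall>v\<in>V. x v \<in> {0..a}) \<and> (\<forall>e\<in>D. x (fst e) - x (snd e) \<in> G)}"

lemma sets_good_heights:
  assumes "finite V" "D \<subseteq> V \<times> V" and [measurable]: "G \<in> sets borel"
  shows "good_heights a G D V \<in> sets (leb V)"
proof -
  have D: "finite D" using assms by (meson finite_SigmaI finite_subset)
  have "{x \<in> space (leb V). x (fst e) - x (snd e) \<in> G} \<in> sets (leb V)" if "e \<in> D" for e
  proof -
    have [measurable]: "fst e \<in> V" "snd e \<in> V" using that assms(2) by auto
    show ?thesis by measurable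
  qed
  then show ?thesis
    unfolding good_heights_def using assms(1) D
    by (intro sets.sets_Collect_conj sets.sets_Collect_finite_All) auto
qed

lemma Ball_gradients_fun_upd:
  assumes v_notin_W: "v \<notin> W" and D: "D \<subseteq> insert v W \<times> insert v W" "sym D" "irrefl D"
    and G: "\<And>y. y \<in> G \<Longrightarrow> - y \<in> G"
  shows "(\<forall>e\<in>D. (x(v := y)) (fst e) - (x(v := y)) (snd e) \<in> G) \<longleftrightarrow>
    (\<forall>e\<in>D \<inter> W \<times> W. x (fst e) - x (snd e) \<in> G) \<and> (\<forall>w\<in>D `` {v}. (y :: real) - x w \<in> G)" (is "?L \<longleftrightarrow> ?R")
proof
  assume all_D: ?L
  show ?R
  proof (intro conjI ballI)
    show "x (fst e) - x (snd e) \<in> G" if "e \<in> D \<inter> W \<times> W" for e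
      using bspec[OF all_D, of e] that v_notin_W by (auto split: if_splits)
    show "y - x w \<in> G" if "w \<in> D `` {v}" for w
      using bspec[OF all_D, of "(v, w)"] that D(3) by (auto simp: irrefl_def split: if_splits)
  qed
next
  assume split: ?R
  show ?L
  proof
    fix e assume "e \<in> D"
    then obtain u w where arc: "e = (u, w)" "(u, w) \<in> D" "(w, u) \<in> D" "u \<noteq> w"
      using D(2,3) by (cases e) (auto simp: irrefl_def dest: symD)
    consider (source) "u = v" | (target) "w = v" | (neither) "u \<in> W" "w \<in> W" using arc D(1) by blast
    then show "(x(v := y)) (fst e) - (x(v := y)) (snd e) \<in> G"
    proof cases
      case source
      then show ?thesis using split arc by auto
    next
      case target
      then have "y - x u \<in> G" using split arc by blast
      then show ?thesis using target arc G[of "y - x u"] by simp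
    next
      case neither
      then have "u \<noteq> v" "w \<noteq> v" using v_notin_W by auto
      then show ?thesis using split arc neither by force
    qed
  qed
qed

lemma fun_upd_in_good_heights_iff:
  assumes v_notin_W: "v \<notin> W" and D: "D \<subseteq> insert v W \<times> insert v W" "sym D" "irrefl D"
    and G: "\<And>y. y \<in> G \<Longrightarrow> - y \<in> G" and x_space: "x \<in> space (leb W)"
  shows "x(v := y) \<in> good_heights a G D (insert v W) \<longleftrightarrow>
    x \<in> good_heights a G (D \<inter> W \<times> W) W \<and> y \<in> {0..a} \<and> (\<forall>w\<in>D `` {v}. y - x w \<in> G)"
proof -
  have "(\<forall>u\<in>insert v W. (x(v := y)) u \<in> {0..a}) \<longleftrightarrow> y \<in> {0..a} \<and> (\<forall>u\<in>W. x u \<in> {0..a})"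
    using v_notin_W by auto
  moreover have "x(v := y) \<in> space (leb (insert v W))"
    using x_space by (auto simp: space_PiM PiE_iff extensional_def)
  ultimately show ?thesis
    using x_space Ball_gradients_fun_upd[OF v_notin_W D G, of x y] unfolding good_heights_def by blast
qed

lemma emeasure_good_heights_insert_ge:
  fixes a \<eta> :: real
  assumes G: "G \<in> sets borel" "\<And>y. y \<in> G \<Longrightarrow> - y \<in> G"
    and bad_le: "emeasure lborel ({-a..a} - G) \<le> ennreal \<eta>" and \<eta>: "0 \<le> \<eta>" "real k * \<eta> \<le> a / 2" and a_pos: "0 < a"
    and W: "finite W" "v \<notin> W"
    and D: "D \<subseteq> insert v W \<times> insert v W" "sym D" "irrefl D" "card (D `` {v}) \<le> k"
  shows "emeasure (leb W) (good_heights a G (D \<inter> W \<times> W) W) * ennreal (a / 2)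
    \<le> emeasure (leb (insert v W)) (good_heights a G D (insert v W))"
proof -
  let ?D = "good_heights a G D (insert v W)" and ?E = "good_heights a G (D \<inter> W \<times> W) W"
  let ?free = "\<lambda>x. {y \<in> {0..a}. \<forall>w\<in>D `` {v}. y - x w \<in> G}"
  have neighbours: "D `` {v} \<subseteq> W" using D(1,3) by (auto simp: irrefl_def)
  then have finN: "finite (D `` {v})" using W(1) by (rule finite_subset)
  note [measurable] = G(1)
  have sets: "?E \<in> sets (leb W)" "?D \<in> sets (leb (insert v W))" "?free x \<in> sets lborel" for x
    using W(1) D(1) G(1) finN by (auto intro!: sets_good_heights)
  have "indicator ?E x * ennreal (a / 2) \<le> (\<integral>\<^sup>+ y. indicator ?D (x(v := y)) \<partial>lborel)"
    if x_space: "x \<in> space (leb W)" for x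
  proof (cases "x \<in> ?E")
    case True
    then have "x w \<in> {0..a}" if "w \<in> D `` {v}" for w using that neighbours by (auto simp: good_heights_def)
    then have "ennreal (a / 2) \<le> emeasure lborel (?free x)"
      by (intro emeasure_Collect_avoiding[OF G(1) bad_le \<eta>(1) finN D(4) \<eta>(2) a_pos])
    also have "\<dots> = (\<integral>\<^sup>+ y. indicator (?free x) y \<partial>lborel)"
      by (rule nn_integral_indicator[OF sets(3), symmetric])
    also have "\<dots> = (\<integral>\<^sup>+ y. indicator ?D (x(v := y)) \<partial>lborel)"
      using True by (simp add: fun_upd_in_good_heights_iff[OF W(2) D(1-3) G(2) x_space] indicator_def)
    finally show ?thesis using True by simp
  qed simp
  then have "(\<integral>\<^sup>+ x. indicator ?E x * ennreal (a / 2) \<partial>leb W) \<le> (\<integral>\<^sup>+ x. (\<integral>\<^sup>+ y. indicator ?D (x(v := y)) \<partial>lborel) \<partial>leb W)"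
    by (rule nn_integral_mono)
  also have "\<dots> = (\<integral>\<^sup>+ x. indicator ?D x \<partial>leb (insert v W))"
    using sets(2) by (intro leb.product_nn_integral_insert[OF W, symmetric]) simp
  finally show ?thesis using sets(1,2) by (simp add: nn_integral_multc)
qed

lemma emeasure_good_heights_ge:
  fixes a \<eta> :: real and D :: "('v \<times> 'v) set"
  assumes G: "G \<in> sets borel" "\<And>y. y \<in> G \<Longrightarrow> - y \<in> G"
    and bad_le: "emeasure lborel ({-a..a} - G) \<le> ennreal \<eta>" and \<eta>: "0 \<le> \<eta>" "real k * \<eta> \<le> a / 2" and a_pos: "0 < a"
    and "finite V" "D \<subseteq> V \<times> V" "sym D" "irrefl D" "\<And>v. card (D `` {v}) \<le> k"
  shows "ennreal ((a / 2) ^ card V) \<le> emeasure (leb V) (good_heights a G D V)"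
  using assms(7-)
proof (induction V arbitrary: D rule: finite_induct)
  case empty
  then show ?case by (simp add: good_heights_def PiM_empty space_PiM)
next
  case (insert v W)
  define E where "E = D \<inter> W \<times> W"
  have "card (E `` {u}) \<le> k" for u
  proof -
    have "finite (D `` {u})"
      using insert.prems(1) insert.hyps(1) by (auto intro: finite_subset[of _ "insert v W"])
    then have "card (E `` {u}) \<le> card (D `` {u})" by (rule card_mono) (auto simp: E_def)
    then show ?thesis using insert.prems(4)[of u] by simp
  qed
  then have IH: "ennreal ((a / 2) ^ card W) \<le> emeasure (leb W) (good_heights a G E W)"
    using insert.prems(2,3) by (intro insert.IH) (auto simp: E_def sym_def irrefl_def)
  have "ennreal ((a / 2) ^ card (insert v W)) = ennreal ((a / 2) ^ card W) * ennreal (a / 2)"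
    using insert.hyps a_pos by (simp add: ennreal_mult[symmetric] mult.commute)
  also have "\<dots> \<le> emeasure (leb W) (good_heights a G E W) * ennreal (a / 2)"
    by (rule mult_right_mono[OF IH]) (rule zero_le)
  also have "\<dots> \<le> emeasure (leb (insert v W)) (good_heights a G D (insert v W))"
    unfolding E_def by (intro emeasure_good_heights_insert_ge[where \<eta> = \<eta> and k = k] G bad_le \<eta> a_pos insert.hyps insert.prems)
  finally show ?case .
qed

lemma pinned_integral_greedy_ge:
  fixes a \<eta> \<epsilon> :: real and D :: "('v \<times> 'v) set" and q :: "real \<Rightarrow> ennreal"
  assumes a_pos: "0 < a" "a \<le> 1" and q: "q \<in> borel_measurable borel" "\<And>y. q (- y) = q y" and \<epsilon>: "0 \<le> \<epsilon>"
    and bad_le: "emeasure lborel {y\<in>{-a..a}. q y < ennreal \<epsilon>} \<le> ennreal \<eta>" and \<eta>: "0 \<le> \<eta>" "real k * \<eta> \<le> a / 2"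
    and V: "finite V" "p \<in> V" and D: "D \<subseteq> V \<times> V" "sym D" "irrefl D" "\<And>v. card (D `` {v}) \<le> k"
  shows "ennreal (\<epsilon> ^ card D * (a / 2) ^ card V) \<le> pinned_integral V p (edge_prod D (\<lambda>_. q))"
proof -
  define G where "G = {y. ennreal \<epsilon> \<le> q y}"
  have G: "G \<in> sets borel" "\<And>y. y \<in> G \<Longrightarrow> - y \<in> G" unfolding G_def using q by (measurable, simp)
  have bad_eq: "{-a..a} - G = {y\<in>{-a..a}. q y < ennreal \<epsilon>}" by (auto simp: G_def)
  have good: "ennreal ((a / 2) ^ card V) \<le> emeasure (leb V) (good_heights a G D V)"
    by (intro emeasure_good_heights_ge[where \<eta> = \<eta> and k = k] G bad_le[folded bad_eq] \<eta> a_pos(1) V(1) D)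
  have good_sets: "good_heights a G D V \<in> sets (leb V)" using V D G by (intro sets_good_heights) auto
  have "ennreal (\<epsilon> ^ card D * (a / 2) ^ card V) = ennreal (\<epsilon> ^ card D) * ennreal ((a / 2) ^ card V)"
    using a_pos \<epsilon> by (simp add: ennreal_mult)
  also have "\<dots> \<le> ennreal (\<epsilon> ^ card D) * emeasure (leb V) (good_heights a G D V)"
    by (rule mult_left_mono[OF good]) simp
  also have "\<dots> = (\<integral>\<^sup>+ x. ennreal (\<epsilon> ^ card D) * indicator (good_heights a G D V) x \<partial>leb V)"
    using good_sets by (rule nn_integral_cmult_indicator[symmetric])
  also have "\<dots> \<le> pinned_integral V p (edge_prod D (\<lambda>_. q))"
    unfolding pinned_integral_def
  proof (rule nn_integral_mono)
    fix x
    show "ennreal (\<epsilon> ^ card D) * indicator (good_heights a G D V) x \<le> indicator {0..1} (x p) * edge_prod D (\<lambda>_. q) x"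
    proof (cases "x \<in> good_heights a G D V")
      case True
      then have "x p \<in> {0..1}" using V(2) a_pos by (auto simp: good_heights_def)
      moreover have "(\<Prod>e\<in>D. ennreal \<epsilon>) \<le> edge_prod D (\<lambda>_. q) x"
        unfolding edge_prod_def using True by (intro prod_mono_ennreal) (auto simp: good_heights_def G_def)
      ultimately show ?thesis using True \<epsilon> by (simp add: ennreal_power)
    qed simp
  qed
  finally show ?thesis .
qed

section \<open>The torus as a directed graph\<close>

abbreviation symmetrize :: "('v \<times> 'v) set \<Rightarrow> ('v \<times> 'v) set" where
  "symmetrize S \<equiv> S \<union> S\<inverse>"

lemma symmetrize_subset: "sym T \<Longrightarrow> S \<subseteq> T \<Longrightarrow> symmetrize S \<subseteq> T"
  by (auto dest: symD)

type_synonym vertex = "int \<times> int"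
type_synonym arc = "vertex \<times> vertex"

definition torus_arcs :: "nat \<Rightarrow> arc set" where
  "torus_arcs n = {(v, w). torus_adj n v w}"

locale torus =
  fixes n :: nat
  assumes n_pos: "n \<ge> 1"
begin

abbreviation V :: "vertex set" where
  "V \<equiv> torus_V n"

abbreviation D :: "arc set" where
  "D \<equiv> torus_arcs n"

abbreviation window :: "int set" where
  "window \<equiv> {- int n + 1..int n}"

definition wrap :: "int \<Rightarrow> int" where
  "wrap x = (x + int n - 1) mod (2 * int n) - int n + 1"

lemma wrap_in_window: "wrap x \<in> window"
proof -
  have "0 \<le> (x + int n - 1) mod (2 * int n)" "(x + int n - 1) mod (2 * int n) < 2 * int n"
    using n_pos by auto
  then show ?thesis unfolding wrap_def atLeastAtMost_iff by linarith
qed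

lemma wrap_mod: "wrap x mod (2 * int n) = x mod (2 * int n)"
proof -
  have "wrap x mod (2 * int n) = ((x + int n - 1) mod (2 * int n) - (int n - 1)) mod (2 * int n)"
    by (simp add: wrap_def algebra_simps)
  then show ?thesis by (simp add: mod_diff_left_eq)
qed

lemma wrap_id: "x \<in> window \<Longrightarrow> wrap x = x"
  unfolding wrap_def by (subst mod_pos_pos_trivial) auto

lemma wrap_eq_iff: "wrap x = wrap y \<longleftrightarrow> x mod (2 * int n) = y mod (2 * int n)"
proof
  show "wrap x = wrap y \<Longrightarrow> x mod (2 * int n) = y mod (2 * int n)" by (metis wrap_mod)
  show "x mod (2 * int n) = y mod (2 * int n) \<Longrightarrow> wrap x = wrap y"
    unfolding wrap_def by (metis add_diff_eq mod_add_left_eq)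
qed

lemma wrap_wrap [simp]:
  "wrap (wrap x) = wrap x" "wrap (wrap x + a) = wrap (x + a)" "wrap (wrap x - a) = wrap (x - a)"
  "wrap (a - wrap x) = wrap (a - x)" "wrap (a - wrap x + b) = wrap (a - x + b)"
  unfolding wrap_eq_iff by (auto intro!: mod_add_cong mod_diff_cong simp: wrap_mod)

lemma wrap_mod_period [simp]: "wrap (x mod (2 * int n)) = wrap x" "wrap (x mod (2 * int n) + a) = wrap (x + a)"
  unfolding wrap_eq_iff by (simp_all add: mod_add_left_eq)

lemma wrap_parity: "wrap x mod 2 = x mod 2"
proof -
  have "wrap x mod (2 * int n) mod 2 = x mod (2 * int n) mod 2" by (simp add: wrap_mod)
  then show ?thesis by (simp add: mod_mod_cancel)
qed

lemma offset_range [simp]: "0 \<le> offset n j x" "offset n j x < 2 * int n"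
  using offset_bounds[OF n_pos, of j x] by simp_all

lemma offset_pos_iff: "0 < offset n j x \<longleftrightarrow> offset n j x \<noteq> 0"
  using offset_range(1)[of j x] by linarith

lemma offset_not_greater [simp]: "\<not> 2 * int n < offset n j x"
  using offset_range(2)[of j x] by linarith

lemma offset_wrap [simp]: "offset n j (wrap x) = offset n j x"
  by (rule offset_cong) (rule wrap_mod)

lemma wrap_Suc_iff:
  assumes "y \<in> window"
  shows "(y - x) mod (2 * int n) = 1 \<longleftrightarrow> y = wrap (x + 1)"
proof -
  have "1 mod (2 * int n) = 1" using n_pos by simp
  then have "(y - x) mod (2 * int n) = 1 \<longleftrightarrow> (y - x) mod (2 * int n) = 1 mod (2 * int n)" by simp
  also have "\<dots> \<longleftrightarrow> y mod (2 * int n) = (x + 1) mod (2 * int n)"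
    by (simp add: mod_eq_dvd_iff algebra_simps)
  also have "\<dots> \<longleftrightarrow> y = wrap (x + 1)" by (metis assms wrap_eq_iff wrap_id)
  finally show ?thesis .
qed

definition arc_right :: "int \<Rightarrow> int \<Rightarrow> arc" where
  "arc_right x y = ((wrap x, wrap y), (wrap (x + 1), wrap y))"

definition arc_up :: "int \<Rightarrow> int \<Rightarrow> arc" where
  "arc_up x y = ((wrap x, wrap y), (wrap x, wrap (y + 1)))"

lemma in_torus_V_iff: "(x, y) \<in> V \<longleftrightarrow> x \<in> window \<and> y \<in> window"
  by (simp add: torus_V_def)

lemma wrap_in_torus_V: "(wrap x, wrap y) \<in> V"
  unfolding in_torus_V_iff using wrap_in_window by blast

lemma torus_arcs_iff:
  "((x, y), (x', y')) \<in> D \<longleftrightarrow> (x, y) \<in> V \<and> (x', y') \<in> V \<and>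
    (x = x' \<and> (y' = wrap (y + 1) \<or> y = wrap (y' + 1)) \<or> y = y' \<and> (x' = wrap (x + 1) \<or> x = wrap (x' + 1)))"
  by (auto simp: torus_arcs_def torus_adj_def in_torus_V_iff diff_one_mod_def wrap_Suc_iff)

lemma sym_torus_arcs: "sym D"
  unfolding sym_def torus_arcs_def torus_adj_def diff_one_mod_def by auto

lemma torus_arcs_eq: "D = symmetrize ({arc_right x y |x y. True} \<union> {arc_up x y |x y. True})"
proof (intro equalityI subsetI)
  fix e assume arc: "e \<in> D"
  obtain x y x' y' where arc_eq: "e = ((x, y), (x', y'))" by (metis surj_pair)
  then have "wrap x = x" "wrap y = y" "wrap x' = x'" "wrap y' = y'"
    using arc by (auto simp: torus_arcs_iff in_torus_V_iff wrap_id)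
  then have "e \<in> {arc_up x y, arc_right x y} \<or> prod.swap e \<in> {arc_up x' y', arc_right x' y'}"
    using arc unfolding arc_eq torus_arcs_iff arc_right_def arc_up_def by auto
  then show "e \<in> symmetrize ({arc_right x y |x y. True} \<union> {arc_up x y |x y. True})"
    unfolding arc_eq by auto
next
  have "arc_right x y \<in> D" "arc_up x y \<in> D" for x y
    by (simp_all add: arc_right_def arc_up_def torus_arcs_iff wrap_in_torus_V)
  then have "symmetrize ({arc_right x y |x y. True} \<union> {arc_up x y |x y. True}) \<subseteq> D"
    by (intro symmetrize_subset sym_torus_arcs) blast
  then show "e \<in> D" if "e \<in> symmetrize ({arc_right x y |x y. True} \<union> {arc_up x y |x y. True})" for e
    using that by (rule subsetD)
qed

lemma finite_torus_V: "finite V"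
  by (simp add: torus_V_def)

lemma origin_in_torus_V: "(0, 0) \<in> V"
  using n_pos by (simp add: torus_V_def)

lemma card_torus_V: "card V = 4 * n\<^sup>2"
proof -
  have "nat (2 * int n) = 2 * n" by simp
  then show ?thesis by (simp add: torus_V_def power2_eq_square)
qed

lemma torus_arcs_subset: "D \<subseteq> V \<times> V"
  by (auto simp: torus_arcs_def torus_adj_def)

lemma finite_torus_arcs: "finite D"
  using torus_arcs_subset finite_torus_V by (meson finite_SigmaI finite_subset)

lemma irrefl_torus_arcs: "irrefl D"
  unfolding irrefl_def torus_arcs_def torus_adj_def diff_one_mod_def by auto

lemma torus_neighbours: "D `` {(x, y)} \<subseteq> {(wrap (x + 1), y), (wrap (x - 1), y), (x, wrap (y + 1)), (x, wrap (y - 1))}"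
proof
  fix w assume "w \<in> D `` {(x, y)}"
  moreover obtain x' y' where w_eq: "w = (x', y')" by (cases w)
  ultimately have arc: "((x, y), (x', y')) \<in> D" by simp
  have "b = wrap (a - 1)" if "a = wrap (b + 1)" "b \<in> window" for a b
    using that by (simp add: wrap_id)
  then show "w \<in> {(wrap (x + 1), y), (wrap (x - 1), y), (x, wrap (y + 1)), (x, wrap (y - 1))}"
    using arc unfolding w_eq torus_arcs_iff in_torus_V_iff by blast
qed

lemma torus_degree_le: "card (D `` {v}) \<le> 4"
proof -
  obtain x y where v_eq: "v = (x, y)" by (cases v)
  let ?l = "[(wrap (x + 1), y), (wrap (x - 1), y), (x, wrap (y + 1)), (x, wrap (y - 1))]"
  have "card (D `` {v}) \<le> card (set ?l)"
    using torus_neighbours[of x y] unfolding v_eq by (intro card_mono) simp_all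
  also have "\<dots> \<le> length ?l" by (rule card_length)
  finally show ?thesis by simp
qed

lemma card_torus_arcs_le: "card D \<le> 16 * n\<^sup>2"
proof -
  have "D = Sigma V (\<lambda>v. D `` {v})" using torus_arcs_subset by auto
  moreover have "finite (D `` {v})" for v using finite_torus_arcs by (rule finite_Image)
  ultimately have "card D = (\<Sum>v\<in>V. card (D `` {v}))"
    using finite_torus_V by (metis card_SigmaI)
  also have "\<dots> \<le> (\<Sum>v\<in>V. 4)" by (intro sum_mono torus_degree_le)
  finally show ?thesis by (simp add: card_torus_V)
qed

lemma torus_arcs_eq_symmetrize_torus_E: "D = symmetrize (torus_E n)"
proof (intro equalityI subrelI)
  fix v w assume arc: "(v, w) \<in> D"
  then have "v \<noteq> w" using irreflD[OF irrefl_torus_arcs] by blast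
  then have "fst v < fst w \<or> fst v = fst w \<and> snd v < snd w \<or> fst w < fst v \<or> fst w = fst v \<and> snd w < snd v"
    by (auto simp: prod_eq_iff)
  then show "(v, w) \<in> symmetrize (torus_E n)"
    using arc symD[OF sym_torus_arcs arc] by (auto simp: torus_E_def torus_arcs_def)
qed (use sym_torus_arcs in \<open>auto simp: torus_E_def torus_arcs_def sym_def\<close>)

lemma torus_E_disjoint: "torus_E n \<inter> (torus_E n)\<inverse> = {}"
  by (auto simp: torus_E_def)

lemma finite_torus_E: "finite (torus_E n)"
  using finite_torus_arcs by (simp add: torus_arcs_eq_symmetrize_torus_E)

lemma card_symmetrize:
  assumes "S \<subseteq> torus_E n"
  shows "card (symmetrize S) = 2 * card S"
proof -
  have "finite S" "S \<inter> S\<inverse> = {}" using assms finite_torus_E torus_E_disjoint by (auto intro: finite_subset)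
  then show ?thesis by (simp add: card_Un_disjoint)
qed

section \<open>Reflections of the torus\<close>

definition reflect :: "int \<Rightarrow> vertex \<Rightarrow> vertex" where
  "reflect j v = (wrap (2 * j - fst v), snd v)"

definition axis :: "int \<Rightarrow> vertex set" where
  "axis j = {v \<in> V. offset n j (fst v) = 0 \<or> offset n j (fst v) = int n}"

definition half :: "int \<Rightarrow> vertex set" where
  "half j = {v \<in> V. 0 < offset n j (fst v) \<and> offset n j (fst v) < int n}"

lemma half_opposite: "half (j + int n) = {v \<in> V. int n < offset n j (fst v)}"
  using offset_range[of j] by (auto simp: half_def offset_opposite[OF n_pos] not_less[symmetric])

lemma half_opposite_opposite: "half (j + int n + int n) = half j"
  unfolding half_opposite by (auto simp: half_def offset_opposite[OF n_pos])

lemma reflect_opposite: "reflect (j + int n) = reflect j"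
proof -
  have "(2 * (j + int n) - x) mod (2 * int n) = (2 * j - x) mod (2 * int n)" for x
    by (simp add: mod_eq_dvd_iff algebra_simps)
  then show ?thesis by (simp add: reflect_def fun_eq_iff wrap_eq_iff)
qed

lemma reflect_in_torus_V: "v \<in> V \<Longrightarrow> reflect j v \<in> V"
  using wrap_in_window by (cases v) (simp add: reflect_def in_torus_V_iff)

lemma offset_reflect_vertex:
  "offset n j (fst (reflect j v)) = (if offset n j (fst v) = 0 then 0 else 2 * int n - offset n j (fst v))"
  by (simp add: reflect_def offset_reflect)

lemma reflect_reflect: "v \<in> V \<Longrightarrow> reflect j (reflect j v) = v"
  by (cases v) (simp add: reflect_def in_torus_V_iff wrap_id)

lemma reflect_axis:
  assumes "v \<in> axis j"
  shows "reflect j v = v"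
proof -
  have "offset n j (fst v) = 0 \<or> offset n j (fst v) = int n" "v \<in> V" using assms by (auto simp: axis_def)
  then have "offset n j (2 * j - fst v) = offset n j (fst v)" by (auto simp: offset_reflect)
  then have "(2 * j - fst v) mod (2 * int n) = fst v mod (2 * int n)"
    by (simp add: offset_def mod_eq_dvd_iff)
  then have "wrap (2 * j - fst v) = fst v"
    using \<open>v \<in> V\<close> by (cases v) (auto simp: in_torus_V_iff wrap_id wrap_eq_iff[symmetric])
  then show ?thesis by (simp add: reflect_def)
qed

lemma reflect_arc_right: "map_prod (reflect j) (reflect j) (arc_right x y) = prod.swap (arc_right (2 * j - 1 - x) y)"
  by (simp add: arc_right_def reflect_def algebra_simps)

lemma reflect_arc_up: "map_prod (reflect j) (reflect j) (arc_up x y) = arc_up (2 * j - x) y"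
  by (simp add: arc_up_def reflect_def)

lemma torus_V_split: "axis j \<union> (half j \<union> half (j + int n)) = V"
  unfolding half_opposite by (auto simp: axis_def half_def offset_pos_iff)

lemma reflection_graph_torus: "reflection_graph (axis j) (half j) (half (j + int n)) (reflect j) D"
proof
  show "finite (axis j)" "finite (half j)" "finite (half (j + int n))"
    using finite_torus_V by (simp_all add: axis_def half_def)
  show "axis j \<inter> half j = {}" "axis j \<inter> half (j + int n) = {}" "half j \<inter> half (j + int n) = {}"
    unfolding half_opposite by (auto simp: axis_def half_def)
  show "v \<in> axis j \<Longrightarrow> reflect j v = v" for v by (rule reflect_axis)
  show "v \<in> half j \<Longrightarrow> reflect j v \<in> half (j + int n)" "v \<in> half (j + int n) \<Longrightarrow> reflect j v \<in> half j" for v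
    using offset_bounds[OF n_pos, of j "fst v"] reflect_in_torus_V[of v j]
    unfolding half_opposite by (auto simp: half_def offset_reflect_vertex)
  show "v \<in> axis j \<union> (half j \<union> half (j + int n)) \<Longrightarrow> reflect j (reflect j v) = v" for v
    unfolding torus_V_split by (rule reflect_reflect)
  show "D \<subseteq> (axis j \<union> (half j \<union> half (j + int n))) \<times> (axis j \<union> (half j \<union> half (j + int n)))"
    unfolding torus_V_split by (rule torus_arcs_subset)
  show "(reflect j v, reflect j w) \<in> D" if "(v, w) \<in> D" for v w
    using that wrap_in_window by (cases v; cases w) (auto simp: reflect_def torus_arcs_iff in_torus_V_iff)
  have "\<not> (v \<in> half j \<and> w \<in> half (j + int n))" if "(v, w) \<in> D" for v w
  proof -
    have "fst v = fst w \<or> fst w = wrap (fst v + 1) \<or> fst v = wrap (fst w + 1)"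
      using that by (cases v; cases w) (auto simp: torus_arcs_iff)
    then have "offset n j (fst v) = offset n j (fst w) \<or> offset n j (fst w) = offset n j (fst v + 1)
        \<or> offset n j (fst v) = offset n j (fst w + 1)"
      by (metis offset_wrap)
    then show ?thesis
      unfolding half_opposite by (auto simp: half_def offset_Suc[OF n_pos] split: if_splits)
  qed
  then show "(v, w) \<in> D \<Longrightarrow> v \<in> half j \<Longrightarrow> w \<notin> half (j + int n)" "(v, w) \<in> D \<Longrightarrow> v \<in> half (j + int n) \<Longrightarrow> w \<notin> half j" for v w
    using symD[OF sym_torus_arcs, of v w] by blast+
qed

section \<open>Spreading sets of arcs\<close>

definition fold_arcs :: "int \<Rightarrow> arc set \<Rightarrow> arc set" where
  "fold_arcs j S = {e. reflect_edges (reflect j) (half (j + int n)) (\<lambda>e. e \<in> S) e}"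

lemma fold_arcs_nearI:
  "e \<in> S \<Longrightarrow> fst e \<notin> half (j + int n) \<Longrightarrow> snd e \<notin> half (j + int n) \<Longrightarrow> e \<in> fold_arcs j S"
  by (simp add: fold_arcs_def reflect_edges_def)

lemma fold_arcs_farI:
  assumes "e \<in> V \<times> V" "fst e \<notin> half j" "snd e \<notin> half j" and reflected_in_S: "map_prod (reflect j) (reflect j) e \<in> S"
  shows "e \<in> fold_arcs j S"
proof (cases "fst e \<in> half (j + int n) \<or> snd e \<in> half (j + int n)")
  case True
  then show ?thesis using reflected_in_S by (simp add: fold_arcs_def reflect_edges_def)
next
  case False
  then have "fst e \<in> axis j" "snd e \<in> axis j"
    using assms(1-3) unfolding half_opposite by (auto simp: half_def axis_def offset_pos_iff)
  then have "map_prod (reflect j) (reflect j) e = e" by (cases e) (simp add: reflect_axis)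
  then show ?thesis using reflected_in_S False by (simp add: fold_arcs_def reflect_edges_def)
qed

lemma sym_fold_arcs: "sym S \<Longrightarrow> sym (fold_arcs j S)"
  by (rule symI) (auto simp: fold_arcs_def reflect_edges_def dest: symD)

abbreviation parity_class :: "int \<Rightarrow> int set" where
  "parity_class p \<equiv> {x. x mod 2 = p}"

definition row_arcs :: "(int \<Rightarrow> int set) \<Rightarrow> arc set" where
  "row_arcs c = symmetrize {arc_right x y |x y. y \<in> c x}"

definition column_arcs :: "int set \<Rightarrow> arc set" where
  "column_arcs J = symmetrize {arc_up x y |x y. x \<in> J}"

lemma sym_row_arcs: "sym (row_arcs c)"
  unfolding row_arcs_def by (rule sym_Un_converse)

lemma sym_column_arcs: "sym (column_arcs J)"
  unfolding column_arcs_def by (rule sym_Un_converse)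

lemma arc_in_torus_V: "arc_right x y \<in> V \<times> V" "arc_up x y \<in> V \<times> V"
  by (simp_all add: arc_right_def arc_up_def wrap_in_torus_V)

lemma row_arcs_fold_word: "row_arcs (fold_word n j c) \<subseteq> fold_arcs j (row_arcs c)"
proof -
  have "arc_right x y \<in> fold_arcs j (row_arcs c)" if y_in_letter: "y \<in> fold_word n j c x" for x y
  proof (cases "offset n j x < int n")
    case True
    have "y \<in> c x" using y_in_letter True by (simp add: fold_word_def)
    then have "arc_right x y \<in> row_arcs c" by (auto simp: row_arcs_def)
    moreover have "offset n j (x + 1) \<le> int n" using True by (simp add: offset_Suc[OF n_pos])
    ultimately show ?thesis
      using True unfolding half_opposite by (intro fold_arcs_nearI) (simp_all add: half_opposite arc_right_def)
  next
    case False
    have "y \<in> c (2 * j - 1 - x)" using y_in_letter False by (simp add: fold_word_def)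
    then have "map_prod (reflect j) (reflect j) (arc_right x y) \<in> row_arcs c"
      unfolding reflect_arc_right row_arcs_def by (cases "arc_right (2 * j - 1 - x) y") force
    then show ?thesis
      using False arc_in_torus_V by (intro fold_arcs_farI) (auto simp: half_def arc_right_def offset_Suc[OF n_pos])
  qed
  then show ?thesis
    unfolding row_arcs_def[of "fold_word n j c"]
    by (intro symmetrize_subset sym_fold_arcs sym_row_arcs) blast
qed

text \<open>A column of parity \<open>p\<close> counts as switched on if one of the two letters next to it is. Reflections through
  the column itself may separate these letters, and then only switch the column off.\<close>

definition parity_columns :: "int \<Rightarrow> (int \<Rightarrow> bool) \<Rightarrow> int set" where
  "parity_columns p c = {x. x mod 2 = p \<and> (c x \<or> c (x - 1))}"

lemma parity_columns_fold_word:
  assumes word: "c \<in> periodic_words n A" and x_on: "x \<in> parity_columns p (fold_word n j c)"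
  shows "x \<in> parity_columns p c \<and> offset n j x \<le> int n \<or> 2 * j - x \<in> parity_columns p c \<and> int n < offset n j x"
proof -
  have axis: "c (2 * j - x) = c x" "c (2 * j - 1 - x) = c (x - 1)" if "offset n j x = 0 \<or> offset n j x = int n"
  proof -
    have "offset n j (2 * j - x) = offset n j x" using that by (auto simp: offset_reflect)
    then have "2 * int n dvd (2 * j - x) - x" by (simp add: offset_def mod_eq_dvd_iff)
    then show "c (2 * j - x) = c x" "c (2 * j - 1 - x) = c (x - 1)"
      by (auto intro!: periodic_words_cong[OF word] simp: mod_eq_dvd_iff algebra_simps)
  qed
  have parity: "(2 * j - x) mod 2 = x mod 2" by presburger
  have letters: "fold_word n j c x = (if offset n j x < int n then c x else c (2 * j - 1 - x))"
    "fold_word n j c (x - 1) = (if offset n j x \<noteq> 0 \<and> offset n j x \<le> int n then c (x - 1) else c (2 * j - x))"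
    using n_pos by (simp_all add: fold_word_def offset_pred[OF n_pos])
  have "x mod 2 = p" "fold_word n j c x \<or> fold_word n j c (x - 1)"
    using x_on by (simp_all add: parity_columns_def)
  then show ?thesis
    using axis parity unfolding letters parity_columns_def by (auto split: if_splits simp: algebra_simps)
qed

lemma column_arcs_fold_word:
  assumes "c \<in> periodic_words n A"
  shows "column_arcs (parity_columns p (fold_word n j c)) \<subseteq> fold_arcs j (column_arcs (parity_columns p c))"
proof -
  have "arc_up x y \<in> fold_arcs j (column_arcs (parity_columns p c))"
    if "x \<in> parity_columns p (fold_word n j c)" for x y
    using parity_columns_fold_word[OF assms that]
  proof
    assume "x \<in> parity_columns p c \<and> offset n j x \<le> int n"
    then show ?thesis
      by (intro fold_arcs_nearI) (auto simp: column_arcs_def half_opposite arc_up_def)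
  next
    assume far: "2 * j - x \<in> parity_columns p c \<and> int n < offset n j x"
    then have "map_prod (reflect j) (reflect j) (arc_up x y) \<in> column_arcs (parity_columns p c)"
      unfolding reflect_arc_up column_arcs_def by blast
    then show ?thesis
      using far arc_in_torus_V by (intro fold_arcs_farI) (auto simp: half_def arc_up_def)
  qed
  then show ?thesis
    unfolding column_arcs_def[of "parity_columns p (fold_word n j c)"]
    by (intro symmetrize_subset sym_fold_arcs sym_column_arcs) blast
qed

definition transpose_arc :: "arc \<Rightarrow> arc" where
  "transpose_arc = map_prod prod.swap prod.swap"

lemma transpose_transpose_arc [simp]: "transpose_arc (transpose_arc e) = e"
  by (cases e) (simp add: transpose_arc_def)

lemma transpose_arc_right: "transpose_arc (arc_right x y) = arc_up y x"
  by (simp add: transpose_arc_def arc_right_def arc_up_def)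

lemma transpose_symmetrize: "transpose_arc ` symmetrize S = symmetrize (transpose_arc ` S)"
  by (force simp: transpose_arc_def image_iff)

lemma transpose_row_arcs: "transpose_arc ` row_arcs (\<lambda>_. J) = column_arcs J"
proof -
  have "transpose_arc ` {arc_right x y |x y. y \<in> J} = {arc_up x y |x y. x \<in> J}"
    by (force simp: transpose_arc_right image_iff)
  then show ?thesis by (simp only: row_arcs_def column_arcs_def transpose_symmetrize)
qed

lemma bij_betw_transpose_arc: "bij_betw transpose_arc D D"
  by (rule bij_betw_byWitness[where f' = transpose_arc])
    (auto simp: transpose_arc_def torus_arcs_iff in_torus_V_iff)

lemma card_wrap_vimage:
  assumes J_window: "J \<subseteq> window"
  shows "card {i \<in> {0..<2 * int n}. wrap (i + k) \<in> J} = card J"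
proof (rule bij_betw_same_card[of "\<lambda>i. wrap (i + k)"], rule bij_betwI[where g = "\<lambda>x. (x - k) mod (2 * int n)"])
  show "(\<lambda>x. (x - k) mod (2 * int n)) \<in> J \<rightarrow> {i \<in> {0..<2 * int n}. wrap (i + k) \<in> J}"
    using J_window n_pos by (auto simp: wrap_id subset_iff)
  show "wrap ((x - k) mod (2 * int n) + k) = x" if "x \<in> J" for x
    using that J_window by (auto simp: wrap_id subset_iff)
  show "(wrap (i + k) - k) mod (2 * int n) = i" if "i \<in> {i \<in> {0..<2 * int n}. wrap (i + k) \<in> J}" for i
  proof -
    have "(wrap (i + k) - k) mod (2 * int n) = (i + k - k) mod (2 * int n)"
      by (intro mod_diff_cong) (simp_all add: wrap_mod)
    then show ?thesis using that by simp
  qed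
qed auto

lemma column_arcs_wrap:
  assumes "J \<subseteq> window"
  shows "column_arcs {x. wrap x \<in> J} = column_arcs J"
proof -
  have "{arc_up x y |x y. wrap x \<in> J} = {arc_up x y |x y. x \<in> J}"
  proof (intro equalityI subsetI)
    fix e assume "e \<in> {arc_up x y |x y. wrap x \<in> J}"
    then obtain x y where "e = arc_up x y" "wrap x \<in> J" by blast
    then have "e = arc_up (wrap x) y \<and> wrap x \<in> J" by (simp add: arc_up_def)
    then show "e \<in> {arc_up x y |x y. x \<in> J}" by blast
  qed (use assms in \<open>force simp: wrap_id\<close>)
  then show ?thesis by (simp add: column_arcs_def)
qed

definition column_letters :: "int set \<Rightarrow> int \<Rightarrow> bool" where
  "column_letters J i \<longleftrightarrow> wrap i \<in> J \<or> wrap (i + 1) \<in> J"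

lemma column_letters_in_periodic_words: "column_letters J \<in> periodic_words n UNIV"
proof (rule periodic_wordsI)
  fix i i' :: int assume "i mod (2 * int n) = i' mod (2 * int n)"
  then have "wrap i = wrap i'" "wrap (i + 1) = wrap (i' + 1)"
    by (auto simp: wrap_eq_iff intro: mod_add_cong)
  then show "column_letters J i = column_letters J i'" by (simp add: column_letters_def)
qed simp

lemma
  assumes J_parity: "J \<subseteq> {x \<in> window. x mod 2 = p}"
  shows parity_columns_column_letters: "parity_columns p (column_letters J) = {x. wrap x \<in> J}"
    and card_column_letters: "card {i \<in> {0..<2 * int n}. column_letters J i} = 2 * card J"
proof -
  have parity: "wrap x \<in> J \<Longrightarrow> x mod 2 = p" for x using J_parity wrap_parity[of x] by auto
  show "parity_columns p (column_letters J) = {x. wrap x \<in> J}"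
  proof (intro set_eqI iffI)
    fix x assume "x \<in> parity_columns p (column_letters J)"
    then have "x mod 2 = p" "wrap x \<in> J \<or> wrap (x + 1) \<in> J \<or> wrap (x - 1) \<in> J"
      by (auto simp: parity_columns_def column_letters_def)
    moreover have "(x + 1) mod 2 \<noteq> x mod 2" "(x - 1) mod 2 \<noteq> x mod 2" by presburger+
    ultimately show "x \<in> {x. wrap x \<in> J}" using parity[of "x + 1"] parity[of "x - 1"] by auto
  qed (use parity in \<open>auto simp: parity_columns_def column_letters_def\<close>)
  define A where "A = (\<lambda>k. {i \<in> {0..<2 * int n}. wrap (i + k) \<in> J})"
  have fin: "finite (A k)" for k by (rule finite_subset[of _ "{0..<2 * int n}"]) (auto simp: A_def)
  have "\<not> (wrap x \<in> J \<and> wrap (x + 1) \<in> J)" for x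
    using parity[of x] parity[of "x + 1"] by (auto, presburger)
  then have disj: "A 0 \<inter> A 1 = {}" by (auto simp: A_def)
  have "{i \<in> {0..<2 * int n}. column_letters J i} = A 0 \<union> A 1"
    by (auto simp: A_def column_letters_def)
  then have "card {i \<in> {0..<2 * int n}. column_letters J i} = card (A 0) + card (A 1)"
    by (simp only: card_Un_disjoint[OF fin fin disj])
  moreover have "card (A k) = card J" for k
    unfolding A_def using J_parity by (intro card_wrap_vimage) auto
  ultimately show "card {i \<in> {0..<2 * int n}. column_letters J i} = 2 * card J" by simp
qed

definition row_letters :: "int \<Rightarrow> arc set \<Rightarrow> int \<Rightarrow> int set" where
  "row_letters p T x = {y \<in> window. y mod 2 = p \<and> arc_right x y \<in> T}"

lemma arc_right_cong:
  "x mod (2 * int n) = x' mod (2 * int n) \<Longrightarrow> y mod (2 * int n) = y' mod (2 * int n) \<Longrightarrow> arc_right x y = arc_right x' y'"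
  by (auto simp: arc_right_def wrap_eq_iff intro: mod_add_cong)

lemma finite_parity_window: "finite {y \<in> window. y mod 2 = p}"
  by (rule finite_subset[of _ window]) auto

lemma finite_row_letters: "finite (row_letters p T x)"
  unfolding row_letters_def by (rule finite_subset[OF _ finite_parity_window[of p]]) auto

lemma row_letters_in_periodic_words: "row_letters p T \<in> periodic_words n (Pow {y \<in> window. y mod 2 = p})"
proof (rule periodic_wordsI)
  fix x x' :: int assume "x mod (2 * int n) = x' mod (2 * int n)"
  then have "arc_right x y = arc_right x' y" for y by (rule arc_right_cong) (rule refl)
  then show "row_letters p T x = row_letters p T x'" by (simp add: row_letters_def)
qed (auto simp: row_letters_def)

lemma row_arcs_row_letters_subset:
  assumes "sym T"
  shows "row_arcs (row_letters p T) \<subseteq> T"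
  unfolding row_arcs_def using assms by (rule symmetrize_subset) (auto simp: row_letters_def)

lemma card_le_row_letters:
  assumes T: "sym T" "T \<subseteq> row_arcs (\<lambda>_. parity_class p)"
  shows "card T \<le> 2 * (\<Sum>x\<in>{0..<2 * int n}. card (row_letters p T x))"
proof -
  let ?L = "SIGMA x:{0..<2 * int n}. row_letters p T x"
  let ?arcs = "(\<lambda>(x, y). arc_right x y) ` ?L"
  have arcs: "arc_right x y \<in> ?arcs" if "arc_right x y \<in> T" "y mod 2 = p" for x y
  proof -
    have eq: "arc_right x y = arc_right (x mod (2 * int n)) (wrap y)"
      by (rule arc_right_cong) (simp_all add: wrap_mod)
    then have "wrap y \<in> row_letters p T (x mod (2 * int n))"
      using that wrap_in_window[of y] by (simp add: row_letters_def wrap_parity)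
    then show ?thesis
      using eq n_pos by (auto intro!: image_eqI[of _ _ "(x mod (2 * int n), wrap y)"])
  qed
  have "T \<subseteq> symmetrize ?arcs"
  proof
    fix e assume in_T: "e \<in> T"
    then obtain x y where "y mod 2 = p" "e = arc_right x y \<or> prod.swap e = arc_right x y"
      using T(2) by (cases e) (fastforce simp: row_arcs_def)
    moreover have "prod.swap e \<in> T" using in_T T(1) by (cases e) (auto dest: symD)
    ultimately have "e \<in> ?arcs \<or> prod.swap e \<in> ?arcs" using arcs[of x y] in_T by metis
    then show "e \<in> symmetrize ?arcs" by (cases e) auto
  qed
  then have "card T \<le> card (symmetrize ?arcs)" using finite_row_letters by (intro card_mono) auto
  also have "\<dots> \<le> card ?arcs + card ?arcs" by (metis card_Un_le card_inverse)
  also have "\<dots> \<le> 2 * card ?L"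
    unfolding mult_2 using finite_row_letters by (intro add_mono card_image_le) auto
  also have "card ?L = (\<Sum>x\<in>{0..<2 * int n}. card (row_letters p T x))"
    using finite_row_letters by (intro card_SigmaI) auto
  finally show ?thesis .
qed

end

section \<open>Masses of tilted models\<close>

locale edge_weight =
  fixes q :: "real \<Rightarrow> ennreal" and Q I a \<epsilon> :: real
  assumes q_measurable [measurable]: "q \<in> borel_measurable borel"
    and q_even: "q (- y) = q y"
    and Q_ge_1: "1 \<le> Q" and q_le: "q y \<le> ennreal Q"
    and I_ge_1: "1 \<le> I" and nn_integral_q_sq: "(\<integral>\<^sup>+ y. q y * q y \<partial>lborel) \<le> ennreal I"
    and a_bounds: "0 < a" "a \<le> 1" and \<epsilon>_bounds: "0 < \<epsilon>" "\<epsilon> \<le> 1"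
    and small_weights: "emeasure lborel {y \<in> {-a..a}. q y < ennreal \<epsilon>} \<le> ennreal (a / 8)"
begin

definition mass_ratio :: real where
  "mass_ratio = Q ^ 16 * I ^ 4 / (\<epsilon> ^ 16 * (a / 2) ^ 4)"

lemma mass_ratio_ge_1: "1 \<le> mass_ratio"
proof -
  have "1 \<le> Q ^ 16 * I ^ 4" using Q_ge_1 I_ge_1 by (simp add: mult_ge1_I)
  moreover have "\<epsilon> ^ 16 * (a / 2) ^ 4 \<le> 1" using \<epsilon>_bounds a_bounds by (intro mult_le_one power_le_one) auto
  ultimately show ?thesis using \<epsilon>_bounds a_bounds by (simp add: mass_ratio_def)
qed

end

locale torus_model = torus n + edge_weight q Q I a \<epsilon> for n q Q I a \<epsilon> +
  fixes L :: real
begin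

definition tilt :: "arc set \<Rightarrow> arc \<Rightarrow> real \<Rightarrow> ennreal" where
  "tilt S e y = q y * (if e \<in> S then indicator {y. L \<le> \<bar>y\<bar>} y else 1)"

lemma tilt_measurable: "tilt S e \<in> borel_measurable borel"
proof -
  have [measurable]: "{y :: real. L \<le> \<bar>y\<bar>} \<in> sets borel" by measurable
  show ?thesis unfolding tilt_def[abs_def] by (cases "e \<in> S") simp_all
qed

lemma tilt_even: "tilt S e (- y) = tilt S e y"
  by (simp add: tilt_def q_even indicator_def)

lemma tilt_antimono: "S \<subseteq> T \<Longrightarrow> tilt T e y \<le> tilt S e y"
  unfolding tilt_def by (intro mult_left_mono) (auto simp: indicator_def)

lemma tilt_empty [simp]: "tilt {} = (\<lambda>_. q)"
  by (simp add: tilt_def fun_eq_iff)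

lemma tilt_le: "tilt S e y \<le> q y"
  using tilt_antimono[of "{}" S e y] by simp

lemma tilt_fold_arcs: "tilt (fold_arcs j S) = reflect_edges (reflect j) (half (j + int n)) (tilt S)"
  by (simp add: fun_eq_iff tilt_def fold_arcs_def reflect_edges_def)

definition mass :: "arc set \<Rightarrow> ennreal" where
  "mass S = pinned_integral V (0, 0) (edge_prod D (tilt S))"

lemma mass_antimono: "S \<subseteq> T \<Longrightarrow> mass T \<le> mass S"
  unfolding mass_def by (intro pinned_integral_mono edge_prod_mono tilt_antimono)

lemma edge_prod_tilt_measurable: "edge_prod D (tilt S) \<in> borel_measurable (leb V)"
  by (intro edge_prod_measurable torus_arcs_subset tilt_measurable)

lemma mass_eq_pinned_at: "p \<in> V \<Longrightarrow> mass S = pinned_integral V p (edge_prod D (tilt S))"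
  unfolding mass_def by (intro pinned_integral_vertex_indep finite_torus_V origin_in_torus_V
      edge_prod_tilt_measurable edge_prod_translation_invariant torus_arcs_subset)

lemma mass_reflection: "(mass S)\<^sup>2 \<le> mass (fold_arcs j S) * mass (fold_arcs (j + int n) S)"
proof -
  let ?p = "(wrap j, wrap 0)"
  have p_axis: "?p \<in> axis j" by (simp add: axis_def wrap_in_torus_V offset_eq_0_iff wrap_mod)
  have "(pinned_integral V ?p (edge_prod D (tilt S)))\<^sup>2
      \<le> pinned_integral V ?p (edge_prod D (tilt (fold_arcs j S)))
        * pinned_integral V ?p (edge_prod D (tilt (fold_arcs (j + int n) S)))"
    unfolding tilt_fold_arcs reflect_opposite half_opposite_opposite torus_V_split[symmetric, of j]
    using p_axis tilt_measurable by (rule reflection_graph.reflection_positivity[OF reflection_graph_torus])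
  then show ?thesis by (simp only: mass_eq_pinned_at[of ?p, OF wrap_in_torus_V])
qed

lemma mass_transpose: "mass (transpose_arc ` S) = mass S"
proof -
  have bij_swap: "bij_betw prod.swap V V"
    by (rule bij_betw_byWitness[where f' = prod.swap]) (auto simp: torus_V_def)
  have "e \<in> transpose_arc ` S \<longleftrightarrow> transpose_arc e \<in> S" for e
    by (metis image_iff transpose_transpose_arc)
  then have tilt: "tilt (transpose_arc ` S) e = tilt S (transpose_arc e)" for e
    by (simp add: tilt_def fun_eq_iff)
  have "edge_prod D (tilt (transpose_arc ` S)) = (\<lambda>x. edge_prod D (tilt S) (\<lambda>v\<in>V. x (prod.swap v)))"
  proof
    fix x
    have "edge_prod D (tilt S) (\<lambda>v\<in>V. x (prod.swap v))
        = (\<Prod>e\<in>D. tilt S e (x (prod.swap (fst e)) - x (prod.swap (snd e))))"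
      unfolding edge_prod_def using torus_arcs_subset by (intro prod.cong) auto
    also have "\<dots> = edge_prod D (tilt (transpose_arc ` S)) x"
      unfolding edge_prod_def tilt
      by (subst prod.reindex_bij_betw[OF bij_betw_transpose_arc, symmetric]) (simp add: transpose_arc_def)
    finally show "edge_prod D (tilt (transpose_arc ` S)) x = edge_prod D (tilt S) (\<lambda>v\<in>V. x (prod.swap v))" ..
  qed
  then have "mass (transpose_arc ` S) = pinned_integral V (prod.swap (0, 0)) (\<lambda>x. edge_prod D (tilt S) (\<lambda>v\<in>V. x (prod.swap v)))"
    by (simp add: mass_def)
  also have "\<dots> = mass S"
    unfolding mass_def by (rule pinned_integral_permute[OF finite_torus_V origin_in_torus_V bij_swap edge_prod_tilt_measurable])
  finally show ?thesis .
qed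

lemma mass_ge: "ennreal ((\<epsilon> ^ 16 * (a / 2) ^ 4) ^ n\<^sup>2) \<le> mass {}"
proof -
  have "(\<epsilon> ^ 16 * (a / 2) ^ 4) ^ n\<^sup>2 = \<epsilon> ^ (16 * n\<^sup>2) * (a / 2) ^ card V"
    by (simp only: power_mult_distrib power_mult card_torus_V)
  also have "\<dots> \<le> \<epsilon> ^ card D * (a / 2) ^ card V"
    using \<epsilon>_bounds a_bounds card_torus_arcs_le by (intro mult_right_mono power_decreasing) auto
  finally have "ennreal ((\<epsilon> ^ 16 * (a / 2) ^ 4) ^ n\<^sup>2) \<le> ennreal (\<epsilon> ^ card D * (a / 2) ^ card V)"
    by (rule ennreal_leI)
  also have "\<dots> \<le> pinned_integral V (0, 0) (edge_prod D (\<lambda>_. q))"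
    using a_bounds \<epsilon>_bounds by (intro pinned_integral_greedy_ge[where k = 4 and \<eta> = "a / 8"] q_measurable q_even small_weights
        finite_torus_V origin_in_torus_V torus_arcs_subset sym_torus_arcs irrefl_torus_arcs torus_degree_le) auto
  finally show ?thesis by (simp add: mass_def)
qed

definition tail :: ennreal where
  "tail = (\<integral>\<^sup>+ y. q y * q y * indicator {y. L \<le> \<bar>y\<bar>} y \<partial>lborel)"

definition corner :: vertex where
  "corner = (- int n + 1, - int n + 1)"

text \<open>The spanning tree is a comb: every column is a path, and the columns are joined along the bottom row.\<close>

definition comb_parent :: "vertex \<Rightarrow> vertex" where
  "comb_parent v = (if snd v \<noteq> - int n + 1 then (fst v, snd v - 1) else (fst v - 1, snd v))"

lemma comb_parent_arc:
  assumes "v \<in> V - {corner}"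
  shows "(comb_parent v, v) \<in> D"
  using assms by (cases v) (auto simp: comb_parent_def torus_arcs_iff in_torus_V_iff corner_def wrap_id)

lemma comb_parent_column_arc:
  assumes "(x, y) \<in> V - {corner}" "y \<noteq> - int n + 1" "x \<in> J"
  shows "(comb_parent (x, y), (x, y)) \<in> column_arcs J" "((x, y), comb_parent (x, y)) \<in> column_arcs J"
proof -
  have "(comb_parent (x, y), (x, y)) = arc_up x (y - 1)"
    using assms(1,2) by (auto simp: comb_parent_def arc_up_def in_torus_V_iff wrap_id)
  then show "(comb_parent (x, y), (x, y)) \<in> column_arcs J" using assms(3) by (auto simp: column_arcs_def)
  then show "((x, y), comb_parent (x, y)) \<in> column_arcs J" by (rule symD[OF sym_column_arcs])
qed

lemma comb_parent_in_torus_V: "v \<in> V - {corner} \<Longrightarrow> comb_parent v \<in> V"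
  using comb_parent_arc torus_arcs_subset by blast

lemma height_comb_parent_less:
  assumes "v \<in> V - {corner}"
  shows "nat (fst (comb_parent v) + snd (comb_parent v) + 2 * int n) < nat (fst v + snd v + 2 * int n)"
  using assms by (cases v) (auto simp: comb_parent_def in_torus_V_iff)

lemma nn_integral_tilt_comb_le:
  assumes v_in_W: "v \<in> V - {corner}"
  shows "(\<integral>\<^sup>+ y. tilt (column_arcs J) (v, comb_parent v) y * tilt (column_arcs J) (comb_parent v, v) (- y) \<partial>lborel)
    \<le> (if fst v \<in> J \<and> snd v \<noteq> - int n + 1 then tail else ennreal I)"
proof (cases "fst v \<in> J \<and> snd v \<noteq> - int n + 1")
  case True
  then show ?thesis
    using comb_parent_column_arc[of "fst v" "snd v" J] v_in_W
    by (auto simp: tail_def tilt_def q_even indicator_def intro!: nn_integral_mono)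
next
  case False
  have "(\<integral>\<^sup>+ y. tilt (column_arcs J) (v, comb_parent v) y * tilt (column_arcs J) (comb_parent v, v) (- y) \<partial>lborel)
      \<le> (\<integral>\<^sup>+ y. q y * q y \<partial>lborel)"
    unfolding tilt_even by (intro nn_integral_mono mult_mono tilt_le) auto
  then show ?thesis using False nn_integral_q_sq by auto
qed

lemma mass_column_arcs_le_comb:
  "mass (column_arcs J) \<le> ennreal (Q ^ (16 * n\<^sup>2)) *
    (\<Prod>v\<in>V - {corner}. if fst v \<in> J \<and> snd v \<noteq> - int n + 1 then tail else ennreal I)"
proof -
  let ?W = "V - {corner}" and ?S = "column_arcs J"
  have corner: "corner \<in> V" using n_pos by (simp add: corner_def in_torus_V_iff)
  then have V_eq: "V = insert corner ?W" by auto
  have "mass ?S = pinned_integral (insert corner ?W) corner (edge_prod D (tilt ?S))"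
    unfolding V_eq[symmetric] by (rule mass_eq_pinned_at[OF corner])
  also have "\<dots> \<le> ennreal (Q ^ card D) *
      (\<Prod>v\<in>?W. \<integral>\<^sup>+ y. tilt ?S (v, comb_parent v) y * tilt ?S (comb_parent v, v) (- y) \<partial>lborel)"
  proof (rule pinned_integral_spanning_tree_le)
    show "comb_parent v \<in> insert corner ?W \<and>
        nat (fst (comb_parent v) + snd (comb_parent v) + 2 * int n) < nat (fst v + snd v + 2 * int n)" if "v \<in> ?W" for v
      unfolding V_eq[symmetric] using that by (intro conjI comb_parent_in_torus_V height_comb_parent_less)
    show "(v, comb_parent v) \<in> D \<and> (comb_parent v, v) \<in> D" if "v \<in> ?W" for v
      using comb_parent_arc[OF that] symD[OF sym_torus_arcs] by blast
    show "tilt ?S e y \<le> ennreal Q" for e y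
      using tilt_le q_le by (rule order_trans)
  qed (use finite_torus_V finite_torus_arcs tilt_measurable Q_ge_1 in auto)
  also have "\<dots> \<le> ennreal (Q ^ (16 * n\<^sup>2)) *
      (\<Prod>v\<in>?W. if fst v \<in> J \<and> snd v \<noteq> - int n + 1 then tail else ennreal I)"
    using Q_ge_1 card_torus_arcs_le
    by (intro mult_mono ennreal_leI power_increasing prod_mono_ennreal nn_integral_tilt_comb_le) auto
  finally show ?thesis .
qed

lemma mass_finite: "mass S < \<infinity>"
proof -
  have "mass S \<le> mass (column_arcs {})" using mass_antimono[of "{}" S] by (simp add: column_arcs_def)
  also have "\<dots> \<le> ennreal (Q ^ (16 * n\<^sup>2)) * (\<Prod>v\<in>V - {corner}. ennreal I)"
    using mass_column_arcs_le_comb[of "{}"] by simp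
  also have "\<dots> < \<infinity>" by (simp add: ennreal_mult_less_top power_less_top_ennreal)
  finally show ?thesis .
qed

lemma card_parity_window:
  assumes "p = 0 \<or> p = 1"
  shows "card {x \<in> window. x mod 2 = p} \<ge> n"
proof -
  define b where "b = - int n + 1 + (p - (- int n + 1)) mod 2"
  have b_parity: "b mod 2 = p" "- int n + 1 \<le> b" "b \<le> - int n + 2"
    using assms by (auto simp: b_def mod_add_right_eq)
  have "n = card ((\<lambda>k. b + 2 * int k) ` {..<n})"
    by (subst card_image) (auto simp: inj_on_def)
  also have "\<dots> \<le> card {x \<in> window. x mod 2 = p}"
    using b_parity by (intro card_mono) (auto intro: finite_subset[of _ window])
  finally show ?thesis .
qed

lemma card_comb_column_vertices_ge:
  assumes "p = 0 \<or> p = 1"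
  shows "n\<^sup>2 \<le> card {v \<in> V - {corner}. fst v mod 2 = p \<and> snd v \<noteq> - int n + 1}"
proof -
  have "{v \<in> V - {corner}. fst v mod 2 = p \<and> snd v \<noteq> - int n + 1} = {x \<in> window. x mod 2 = p} \<times> {- int n + 2..int n}"
    by (auto simp: corner_def torus_V_def)
  moreover have "nat (2 * int n) = 2 * n" by simp
  ultimately have "card {v \<in> V - {corner}. fst v mod 2 = p \<and> snd v \<noteq> - int n + 1}
      = card {x \<in> window. x mod 2 = p} * (2 * n - 1)"
    by (simp add: card_cartesian_product nat_diff_distrib')
  moreover have "n * n \<le> card {x \<in> window. x mod 2 = p} * (2 * n - 1)"
    using card_parity_window[OF assms] n_pos by (intro mult_le_mono) auto
  ultimately show ?thesis by (simp add: power2_eq_square)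
qed

lemma mass_parity_columns_le:
  assumes \<tau>: "0 \<le> \<tau>" "\<tau> \<le> 1" "tail \<le> ennreal \<tau>" and p_parity: "p = 0 \<or> p = 1"
  shows "mass (column_arcs (parity_class p)) \<le> ennreal ((Q ^ 16 * I ^ 4 * \<tau>) ^ n\<^sup>2)"
proof -
  let ?W = "V - {corner}"
  define G where "G = {v \<in> ?W. fst v mod 2 = p \<and> snd v \<noteq> - int n + 1}"
  have card_G: "n\<^sup>2 \<le> card G"
    unfolding G_def by (rule card_comb_column_vertices_ge[OF p_parity])
  have card_rest: "card (?W - G) \<le> 4 * n\<^sup>2"
    unfolding card_torus_V[symmetric] using finite_torus_V by (intro card_mono) auto
  have "mass (column_arcs (parity_class p)) \<le> ennreal (Q ^ (16 * n\<^sup>2)) * (\<Prod>v\<in>?W. ennreal (if v \<in> G then \<tau> else I))"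
    using \<tau>(3) by (intro order_trans[OF mass_column_arcs_le_comb] mult_left_mono prod_mono_ennreal) (auto simp: G_def)
  also have "(\<Prod>v\<in>?W. ennreal (if v \<in> G then \<tau> else I)) = ennreal (\<Prod>v\<in>?W. if v \<in> G then \<tau> else I)"
    using I_ge_1 \<tau> by (intro prod_ennreal) auto
  also have "(\<Prod>v\<in>?W. if v \<in> G then \<tau> else I) = \<tau> ^ card G * I ^ card (?W - G)"
  proof -
    have "?W \<inter> G = G" "?W \<inter> - G = ?W - G" by (auto simp: G_def)
    then show ?thesis using finite_torus_V by (simp add: prod.If_cases Collect_mem_eq)
  qed
  also have "ennreal (Q ^ (16 * n\<^sup>2)) * ennreal (\<tau> ^ card G * I ^ card (?W - G))
      = ennreal (Q ^ (16 * n\<^sup>2) * (\<tau> ^ card G * I ^ card (?W - G)))"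
    using Q_ge_1 I_ge_1 \<tau> by (intro ennreal_mult[symmetric]) auto
  also have "\<dots> \<le> ennreal (Q ^ (16 * n\<^sup>2) * (\<tau> ^ n\<^sup>2 * I ^ (4 * n\<^sup>2)))"
    using Q_ge_1 I_ge_1 \<tau> card_G card_rest by (intro ennreal_leI mult_left_mono mult_mono power_decreasing power_increasing) auto
  also have "Q ^ (16 * n\<^sup>2) * (\<tau> ^ n\<^sup>2 * I ^ (4 * n\<^sup>2)) = (Q ^ 16 * I ^ 4 * \<tau>) ^ n\<^sup>2"
    by (simp add: power_mult_distrib power_mult)
  finally show ?thesis .
qed

section \<open>Chessboard bounds on the torus\<close>

definition prob :: "arc set \<Rightarrow> real" where
  "prob S = enn2real (mass S) / enn2real (mass {})"

lemma mass_empty_pos: "0 < enn2real (mass {})"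
proof -
  have "0 < ennreal ((\<epsilon> ^ 16 * (a / 2) ^ 4) ^ n\<^sup>2)" using \<epsilon>_bounds a_bounds by simp
  also have "\<dots> \<le> mass {}" by (rule mass_ge)
  finally show ?thesis using mass_finite[of "{}"] by (simp add: enn2real_positive_iff)
qed

lemma prob_nonneg: "0 \<le> prob S"
  by (simp add: prob_def)

lemma prob_empty: "prob {} = 1"
  using mass_empty_pos by (simp add: prob_def)

lemma prob_antimono: "S \<subseteq> T \<Longrightarrow> prob T \<le> prob S"
  unfolding prob_def using mass_finite[of S]
  by (intro divide_right_mono enn2real_mono mass_antimono) auto

lemma prob_le_1: "prob S \<le> 1"
  using prob_antimono[of "{}" S] prob_empty by simp

lemma prob_transpose: "prob (transpose_arc ` S) = prob S"
  by (simp add: prob_def mass_transpose)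

lemma prob_reflection: "(prob S)\<^sup>2 \<le> prob (fold_arcs j S) * prob (fold_arcs (j + int n) S)"
proof -
  have "enn2real ((mass S)\<^sup>2) \<le> enn2real (mass (fold_arcs j S) * mass (fold_arcs (j + int n) S))"
    using mass_finite by (intro enn2real_mono mass_reflection) (simp add: ennreal_mult_less_top)
  then have "(enn2real (mass S))\<^sup>2 \<le> enn2real (mass (fold_arcs j S)) * enn2real (mass (fold_arcs (j + int n) S))"
    by (simp add: power2_eq_square enn2real_mult)
  then show ?thesis
    by (simp add: prob_def power_divide power2_eq_square divide_right_mono)
qed

lemma prob_fold_mono:
  assumes "T \<subseteq> fold_arcs j S" "T' \<subseteq> fold_arcs (j + int n) S"
  shows "(prob S)\<^sup>2 \<le> prob T * prob T'"
  using prob_reflection[of S j] mult_mono[OF prob_antimono[OF assms(1)] prob_antimono[OF assms(2)]]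
  by (force intro: order_trans simp: prob_nonneg)

lemma row_chessboard:
  assumes "finite A" "c \<in> periodic_words n A"
  shows "prob (row_arcs c) ^ (2 * n) \<le> (\<Prod>i\<in>{0..<2 * int n}. prob (row_arcs (\<lambda>_. c i)))"
proof (rule chessboard_estimate[OF n_pos assms])
  show "(prob (row_arcs d))\<^sup>2 \<le> prob (row_arcs (fold_word n j d)) * prob (row_arcs (fold_word n (j + int n) d))" for d j
    by (intro prob_fold_mono[where j = j] row_arcs_fold_word)
qed (rule prob_nonneg)

lemma column_word_chessboard:
  assumes "c \<in> periodic_words n UNIV"
  shows "prob (column_arcs (parity_columns p c)) ^ (2 * n)
    \<le> prob (column_arcs (parity_class p)) ^ card {i \<in> {0..<2 * int n}. c i}"
proof -
  have "prob (column_arcs (parity_columns p c)) ^ (2 * n)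
      \<le> (\<Prod>i\<in>{0..<2 * int n}. prob (column_arcs (parity_columns p (\<lambda>_. c i))))"
  proof (rule chessboard_estimate[OF n_pos _ assms, where \<Phi> = "\<lambda>c. prob (column_arcs (parity_columns p c))"])
    fix d :: "int \<Rightarrow> bool" and j assume "d \<in> periodic_words n UNIV"
    then show "(prob (column_arcs (parity_columns p d)))\<^sup>2 \<le> prob (column_arcs (parity_columns p (fold_word n j d)))
        * prob (column_arcs (parity_columns p (fold_word n (j + int n) d)))"
      by (intro prob_fold_mono[where j = j] column_arcs_fold_word)
  qed (simp_all add: prob_nonneg)
  also have "\<dots> = (\<Prod>i\<in>{0..<2 * int n}. if c i then prob (column_arcs (parity_class p)) else 1)"
    by (intro prod.cong) (auto simp: parity_columns_def column_arcs_def prob_empty)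
  also have "\<dots> = prob (column_arcs (parity_class p)) ^ card {i \<in> {0..<2 * int n}. c i}"
    by (subst prod.If_cases) (auto simp: Int_def)
  finally show ?thesis .
qed

lemma column_chessboard:
  assumes J_parity: "J \<subseteq> {x \<in> window. x mod 2 = p}"
  shows "prob (column_arcs J) ^ (2 * n) \<le> prob (column_arcs (parity_class p)) ^ (2 * card J)"
proof -
  have "J \<subseteq> window" using J_parity by auto
  then show ?thesis
    using column_word_chessboard[OF column_letters_in_periodic_words, of p J]
    by (simp only: parity_columns_column_letters[OF J_parity] card_column_letters[OF J_parity] column_arcs_wrap)
qed

lemma row_word_bound:
  assumes word: "c \<in> periodic_words n (Pow {y \<in> window. y mod 2 = p})"
  shows "prob (row_arcs c) ^ (2 * n)\<^sup>2
    \<le> prob (column_arcs (parity_class p)) ^ (2 * (\<Sum>i\<in>{0..<2 * int n}. card (c i)))"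
proof -
  have fin: "finite (Pow {y \<in> window. y mod 2 = p})"
    unfolding finite_Pow_iff by (rule finite_parity_window)
  have letters_subset: "c i \<subseteq> {y \<in> window. y mod 2 = p}" for i using periodic_words_in[OF word] by blast
  have "prob (row_arcs c) ^ (2 * n)\<^sup>2 = (prob (row_arcs c) ^ (2 * n)) ^ (2 * n)"
    by (simp add: power_mult[symmetric] power2_eq_square)
  also have "\<dots> \<le> (\<Prod>i\<in>{0..<2 * int n}. prob (row_arcs (\<lambda>_. c i))) ^ (2 * n)"
    by (intro power_mono row_chessboard[OF fin word] zero_le_power prob_nonneg)
  also have "\<dots> = (\<Prod>i\<in>{0..<2 * int n}. prob (column_arcs (c i)) ^ (2 * n))"
    by (simp add: prod_power_distrib transpose_row_arcs[symmetric] prob_transpose)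
  also have "\<dots> \<le> (\<Prod>i\<in>{0..<2 * int n}. prob (column_arcs (parity_class p)) ^ (2 * card (c i)))"
    by (intro prod_mono conjI column_chessboard letters_subset zero_le_power prob_nonneg)
  also have "\<dots> = prob (column_arcs (parity_class p)) ^ (2 * (\<Sum>i\<in>{0..<2 * int n}. card (c i)))"
    by (simp add: power_sum sum_distrib_left)
  finally show ?thesis .
qed

lemma row_arcs_bound:
  assumes T: "sym T" "T \<subseteq> row_arcs (\<lambda>_. parity_class p)"
  shows "prob T ^ (2 * n)\<^sup>2 \<le> prob (column_arcs (parity_class p)) ^ card T"
proof -
  have "prob T ^ (2 * n)\<^sup>2 \<le> prob (row_arcs (row_letters p T)) ^ (2 * n)\<^sup>2"
    by (intro power_mono prob_antimono row_arcs_row_letters_subset T(1) prob_nonneg)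
  also have "\<dots> \<le> prob (column_arcs (parity_class p)) ^ (2 * (\<Sum>x\<in>{0..<2 * int n}. card (row_letters p T x)))"
    by (rule row_word_bound[OF row_letters_in_periodic_words])
  also have "\<dots> \<le> prob (column_arcs (parity_class p)) ^ card T"
    by (intro power_decreasing card_le_row_letters T prob_nonneg prob_le_1)
  finally show ?thesis .
qed

lemma column_arcs_bound:
  assumes T: "sym T" "T \<subseteq> column_arcs (parity_class p)"
  shows "prob T ^ (2 * n)\<^sup>2 \<le> prob (column_arcs (parity_class p)) ^ card T"
proof -
  have "inj_on transpose_arc T" by (rule inj_on_inverseI[where g = transpose_arc]) simp
  then have "card (transpose_arc ` T) = card T" by (rule card_image)
  moreover have "transpose_arc ` T \<subseteq> row_arcs (\<lambda>_. parity_class p)"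
    using image_mono[OF T(2), of transpose_arc] by (simp add: transpose_row_arcs[symmetric] image_image)
  moreover have "sym (transpose_arc ` T)"
    using T(1) by (force simp: sym_def transpose_arc_def)
  ultimately show ?thesis using row_arcs_bound[of "transpose_arc ` T" p] by (simp add: prob_transpose)
qed

lemma torus_arcs_classes:
  "D \<subseteq> (row_arcs (\<lambda>_. parity_class 0) \<union> row_arcs (\<lambda>_. parity_class 1))
    \<union> (column_arcs (parity_class 0) \<union> column_arcs (parity_class 1))"
proof -
  have "x mod 2 = 0 \<or> x mod 2 = 1" for x :: int by presburger
  then show ?thesis unfolding torus_arcs_eq row_arcs_def column_arcs_def by blast
qed

lemma prob_le_parity_columns:
  assumes T: "sym T" "T \<subseteq> D"
  obtains p :: int where "p = 0 \<or> p = 1"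
    "prob T ^ ((2 * n)\<^sup>2 * 4) \<le> prob (column_arcs (parity_class p)) ^ card T"
proof -
  let ?R = "\<lambda>p. T \<inter> row_arcs (\<lambda>_. parity_class p)" and ?C = "\<lambda>p. T \<inter> column_arcs (parity_class p)"
  have "T = (?R 0 \<union> ?R 1) \<union> (?C 0 \<union> ?C 1)" using T(2) torus_arcs_classes by blast
  then have "card T = card ((?R 0 \<union> ?R 1) \<union> (?C 0 \<union> ?C 1))" by (rule arg_cong)
  also have "\<dots> \<le> (card (?R 0) + card (?R 1)) + (card (?C 0) + card (?C 1))"
    by (intro order_trans[OF card_Un_le] add_mono card_Un_le)
  finally have "card T \<le> (card (?R 0) + card (?R 1)) + (card (?C 0) + card (?C 1))" .
  then have "card T \<le> 4 * card (?R 0) \<or> card T \<le> 4 * card (?R 1)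
      \<or> card T \<le> 4 * card (?C 0) \<or> card T \<le> 4 * card (?C 1)" by linarith
  then obtain p T' where piece: "p = 0 \<or> p = 1" "T' = ?R p \<or> T' = ?C p" "card T \<le> 4 * card T'" by blast
  have "prob T' ^ (2 * n)\<^sup>2 \<le> prob (column_arcs (parity_class p)) ^ card T'"
    using piece(2) T(1) row_arcs_bound[of "?R p" p] column_arcs_bound[of "?C p" p]
    by (auto simp: sym_Int sym_row_arcs sym_column_arcs)
  moreover have "prob T \<le> prob T'" using piece(2) by (intro prob_antimono) auto
  ultimately have "(prob T ^ (2 * n)\<^sup>2) ^ 4 \<le> (prob (column_arcs (parity_class p)) ^ card T') ^ 4"
    by (meson order_trans power_mono prob_nonneg zero_le_power)
  also have "\<dots> \<le> prob (column_arcs (parity_class p)) ^ card T"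
    unfolding power_mult[symmetric] using piece(3) by (intro power_decreasing prob_nonneg prob_le_1) simp
  finally show thesis by (rule that[OF piece(1), unfolded power_mult])
qed

lemma prob_parity_columns_le:
  assumes \<tau>: "0 \<le> \<tau>" "\<tau> \<le> 1" "tail \<le> ennreal \<tau>" and p_parity: "p = 0 \<or> p = 1"
  shows "prob (column_arcs (parity_class p)) \<le> (mass_ratio * \<tau>) ^ n\<^sup>2"
proof -
  let ?z = "\<epsilon> ^ 16 * (a / 2) ^ 4"
  have z_pos: "0 < ?z" using \<epsilon>_bounds a_bounds by simp
  have numerator_nonneg: "0 \<le> Q ^ 16 * I ^ 4 * \<tau>" using Q_ge_1 I_ge_1 \<tau>(1) by simp
  have "enn2real (mass (column_arcs (parity_class p))) \<le> (Q ^ 16 * I ^ 4 * \<tau>) ^ n\<^sup>2"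
    using enn2real_mono[OF mass_parity_columns_le[OF \<tau> p_parity] ennreal_less_top] numerator_nonneg by simp
  moreover have "?z ^ n\<^sup>2 \<le> enn2real (mass {})"
    using enn2real_mono[OF mass_ge] mass_finite[of "{}"] z_pos by simp
  ultimately have "prob (column_arcs (parity_class p)) \<le> (Q ^ 16 * I ^ 4 * \<tau>) ^ n\<^sup>2 / ?z ^ n\<^sup>2"
    unfolding prob_def using z_pos numerator_nonneg by (intro frac_le) auto
  also have "\<dots> = (mass_ratio * \<tau>) ^ n\<^sup>2" unfolding power_divide[symmetric] by (simp add: mass_ratio_def)
  finally show ?thesis .
qed

lemma prob_power_8_le:
  assumes S_edges: "S \<subseteq> torus_E n" and \<tau>: "0 \<le> \<tau>" "tail \<le> ennreal \<tau>"
  shows "prob (symmetrize S) ^ 8 \<le> (mass_ratio * \<tau>) ^ card S"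
proof (cases "mass_ratio * \<tau> \<le> 1")
  case False
  have "prob (symmetrize S) ^ 8 \<le> 1" by (intro power_le_one prob_nonneg prob_le_1)
  also have "\<dots> \<le> (mass_ratio * \<tau>) ^ card S" using False by (intro one_le_power) simp
  finally show ?thesis .
next
  case True
  have "\<tau> \<le> mass_ratio * \<tau>" using mult_right_mono[OF mass_ratio_ge_1 \<tau>(1)] by simp
  then have \<tau>_le_1: "\<tau> \<le> 1" using True by simp
  have T: "sym (symmetrize S)" "symmetrize S \<subseteq> D"
    using S_edges sym_Un_converse by (auto simp: torus_arcs_eq_symmetrize_torus_E)
  obtain p :: int where p_parity: "p = 0 \<or> p = 1"
    and spread: "prob (symmetrize S) ^ ((2 * n)\<^sup>2 * 4) \<le> prob (column_arcs (parity_class p)) ^ card (symmetrize S)"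
    using T by (rule prob_le_parity_columns)
  have "(prob (symmetrize S) ^ 8) ^ (2 * n\<^sup>2) = prob (symmetrize S) ^ ((2 * n)\<^sup>2 * 4)"
    unfolding power_mult[symmetric] by (simp add: power_mult_distrib)
  also note spread
  also have "prob (column_arcs (parity_class p)) ^ card (symmetrize S) \<le> ((mass_ratio * \<tau>) ^ n\<^sup>2) ^ (2 * card S)"
    unfolding card_symmetrize[OF S_edges] by (intro power_mono prob_parity_columns_le \<tau> \<tau>_le_1 p_parity prob_nonneg)
  also have "\<dots> = ((mass_ratio * \<tau>) ^ card S) ^ (2 * n\<^sup>2)"
    unfolding power_mult[symmetric] by (simp add: ac_simps)
  finally have "(prob (symmetrize S) ^ 8) ^ (2 * n\<^sup>2) \<le> ((mass_ratio * \<tau>) ^ card S) ^ (2 * n\<^sup>2)" .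
  then show ?thesis
    using n_pos mass_ratio_ge_1 \<tau>(1) by (subst (asm) power_mono_iff) (auto simp: prob_nonneg)
qed

end

section \<open>The Gibbs measure\<close>

lemma exp_neg_le: "ereal c \<le> x \<Longrightarrow> exp_neg x \<le> ennreal (exp (- c))"
  by (cases x) (auto simp: exp_neg_def intro!: ennreal_leI)

lemma exp_neg_eq_0_iff: "exp_neg x = 0 \<longleftrightarrow> x = \<infinity>"
  by (cases x) (simp_all add: exp_neg_def)

lemma exp_neg_add: "x \<noteq> -\<infinity> \<Longrightarrow> y \<noteq> -\<infinity> \<Longrightarrow> exp_neg (x + y) = exp_neg x * exp_neg y"
  by (cases x; cases y) (auto simp: exp_neg_def ennreal_mult[symmetric] exp_add[symmetric])

lemma exp_neg_sum:
  assumes "finite E" "\<And>e. e \<in> E \<Longrightarrow> f e \<noteq> -\<infinity>"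
  shows "exp_neg (sum f E) = (\<Prod>e\<in>E. exp_neg (f e))"
proof -
  have "sum f E \<noteq> -\<infinity> \<and> exp_neg (sum f E) = (\<Prod>e\<in>E. exp_neg (f e))"
    using assms by (induction E rule: finite_induct) (auto simp: exp_neg_add, simp add: exp_neg_def)
  then show ?thesis ..
qed

lemma borel_measurable_exp_neg:
  assumes [measurable]: "f \<in> borel_measurable M"
  shows "(\<lambda>x. exp_neg (f x)) \<in> borel_measurable M"
  unfolding exp_neg_def by measurable

lemma (in torus) edge_prod_arcs:
  "edge_prod D f x = (\<Prod>e\<in>torus_E n. f e (x (fst e) - x (snd e)) * f (prod.swap e) (- (x (fst e) - x (snd e))))"
proof -
  have "edge_prod D f x = edge_prod (torus_E n) f x * edge_prod ((torus_E n)\<inverse>) f x"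
    unfolding torus_arcs_eq_symmetrize_torus_E
    using finite_torus_E torus_E_disjoint by (intro edge_prod_Un_disjoint) simp_all
  also have "edge_prod ((torus_E n)\<inverse>) f x
      = (\<Prod>e\<in>torus_E n. f (prod.swap e) (- (x (fst e) - x (snd e))))"
    unfolding edge_prod_def
    by (rule prod.reindex_bij_witness[of _ prod.swap prod.swap]) auto
  finally show ?thesis by (simp add: edge_prod_def prod.distrib)
qed

definition large_gradients :: "real \<Rightarrow> ('v \<times> 'v) set \<Rightarrow> ('v \<Rightarrow> real) set" where
  "large_gradients L S = {\<phi>. \<forall>(v, w)\<in>S. \<bar>\<phi> v - \<phi> w\<bar> \<ge> L}"

lemma indicator_large_gradients:
  assumes "finite S"
  shows "indicator (large_gradients L S) \<phi> = (\<Prod>e\<in>S. indicator {y. L \<le> \<bar>y\<bar>} (\<phi> (fst e) - \<phi> (snd e)) :: ennreal)"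
  using assms by (induction S rule: finite_induct) (auto simp: large_gradients_def indicator_def case_prod_beta)

context torus_model
begin

context
  fixes U :: "real \<Rightarrow> ereal"
  assumes q_sq: "\<And>y. q y * q y = exp_neg (U y)" and U_not_MInf: "\<And>y. U y \<noteq> -\<infinity>"
begin

lemma exp_neg_hamiltonian:
  assumes S_edges: "S \<subseteq> torus_E n"
  shows "exp_neg (hamiltonian n U \<phi>) * indicator (large_gradients L S) \<phi> = edge_prod D (tilt (symmetrize S)) \<phi>"
proof -
  let ?E = "torus_E n" and ?d = "\<lambda>e. \<phi> (fst e) - \<phi> (snd e)"
  let ?i = "\<lambda>e. if e \<in> S then indicator {y. L \<le> \<bar>y\<bar>} (?d e) else 1 :: ennreal"
  have "edge_prod D (tilt (symmetrize S)) \<phi> = (\<Prod>e\<in>?E. exp_neg (U (?d e)) * ?i e)"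
    unfolding edge_prod_arcs
  proof (rule prod.cong)
    fix e assume "e \<in> ?E"
    then have "prod.swap e \<notin> ?E" using torus_E_disjoint by (cases e) auto
    then have "e \<in> symmetrize S \<longleftrightarrow> e \<in> S" "prod.swap e \<in> symmetrize S \<longleftrightarrow> e \<in> S"
      using S_edges \<open>e \<in> ?E\<close> by (cases e; force)+
    then have "tilt (symmetrize S) e y * tilt (symmetrize S) (prod.swap e) (- y)
        = exp_neg (U y) * (if e \<in> S then indicator {y. L \<le> \<bar>y\<bar>} y else 1)" for y
      by (simp add: tilt_def q_even q_sq[symmetric] indicator_def)
    then show "tilt (symmetrize S) e (?d e) * tilt (symmetrize S) (prod.swap e) (- ?d e) = exp_neg (U (?d e)) * ?i e" .
  qed simp
  also have "\<dots> = (\<Prod>e\<in>?E. exp_neg (U (?d e))) * (\<Prod>e\<in>?E. ?i e)" by (rule prod.distrib)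
  also have "(\<Prod>e\<in>?E. exp_neg (U (?d e))) = exp_neg (hamiltonian n U \<phi>)"
    unfolding hamiltonian_def using U_not_MInf
    by (subst exp_neg_sum[OF finite_torus_E]) (auto simp: case_prod_beta)
  also have "(\<Prod>e\<in>?E. ?i e) = indicator (large_gradients L S) \<phi>"
    using S_edges finite_torus_E indicator_large_gradients[of S]
    by (subst prod.inter_restrict[symmetric]) (auto simp: Int_absorb1 finite_subset)
  finally show ?thesis ..
qed

lemma nn_integral_large_gradients:
  assumes "S \<subseteq> torus_E n"
  shows "(\<integral>\<^sup>+ \<phi>. exp_neg (hamiltonian n U \<phi>) * indicator (large_gradients L S) \<phi> \<partial>ref_measure n) = mass (symmetrize S)"
  unfolding exp_neg_hamiltonian[OF assms] ref_measure_def mass_def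
  by (intro nn_integral_pinned_at_0 finite_torus_V origin_in_torus_V edge_prod_tilt_measurable
      edge_prod_translation_invariant torus_arcs_subset)

lemma partition_fn_eq_mass: "partition_fn n U = mass {}"
  using nn_integral_large_gradients[of "{}"] by (simp add: partition_fn_def large_gradients_def)

lemma gibbs_prob_large_gradients:
  assumes "S \<subseteq> torus_E n"
  shows "gibbs_prob n U (large_gradients L S) = ennreal (prob (symmetrize S))"
proof -
  have "gibbs_prob n U (large_gradients L S) = mass (symmetrize S) / mass {}"
    unfolding gibbs_prob_def nn_integral_large_gradients[OF assms] partition_fn_eq_mass ..
  also have "\<dots> = ennreal (enn2real (mass (symmetrize S))) / ennreal (enn2real (mass {}))"
    using mass_finite by simp
  also have "\<dots> = ennreal (prob (symmetrize S))"
    unfolding prob_def using mass_empty_pos by (intro divide_ennreal) auto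
  finally show ?thesis .
qed

end

end

section \<open>Controlled gradients\<close>

lemma nn_integral_indicator_LIMSEQ_0:
  fixes w :: "'a \<Rightarrow> ennreal" and A :: "nat \<Rightarrow> 'a set"
  assumes [measurable]: "w \<in> borel_measurable M" and int_fin: "(\<integral>\<^sup>+ x. w x \<partial>M) < \<infinity>"
    and [measurable]: "\<And>k. A k \<in> sets M"
    and leave: "AE x in M. w x \<noteq> 0 \<longrightarrow> (\<forall>\<^sub>F k in sequentially. x \<notin> A k)"
  shows "(\<lambda>k. \<integral>\<^sup>+ x. w x * indicator (A k) x \<partial>M) \<longlonglongrightarrow> 0"
proof -
  have "(\<lambda>k. \<integral>\<^sup>+ x. w x * indicator (A k) x \<partial>M) \<longlonglongrightarrow> (\<integral>\<^sup>+ x. 0 \<partial>M)"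
  proof (rule nn_integral_dominated_convergence[where w = w])
    show "AE x in M. (\<lambda>k. w x * indicator (A k) x) \<longlonglongrightarrow> 0"
      using leave
    proof eventually_elim
      case (elim x)
      then have "\<forall>\<^sub>F k in sequentially. w x * indicator (A k) x = 0"
        by (cases "w x = 0") (auto elim: eventually_mono)
      then show ?case by (rule tendsto_eventually)
    qed
  qed (use int_fin in \<open>auto simp: indicator_def\<close>)
  then show ?thesis by simp
qed

lemma LIMSEQ_0_ennreal_le:
  fixes f :: "nat \<Rightarrow> ennreal" and r :: real
  assumes "f \<longlonglongrightarrow> 0" "0 < r"
  obtains k where "f k \<le> ennreal r"
proof -
  have "\<forall>\<^sub>F k in sequentially. f k < ennreal r" using assms by (intro order_tendstoD(2)) auto
  then show thesis using that by (auto simp: eventually_sequentially intro: less_imp_le)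
qed

lemma ex_small_sublevel_set:
  fixes q :: "real \<Rightarrow> ennreal" and a \<eta> :: real
  assumes [measurable]: "q \<in> borel_measurable borel" and pos: "\<And>y. \<bar>y\<bar> \<le> a \<Longrightarrow> 0 < q y" and \<eta>: "0 < \<eta>"
  obtains \<epsilon> :: real where "0 < \<epsilon>" "\<epsilon> \<le> 1" "emeasure lborel {y \<in> {-a..a}. q y < ennreal \<epsilon>} \<le> ennreal \<eta>"
proof -
  let ?A = "\<lambda>k. {y \<in> {-a..a}. q y < ennreal (inverse (real (Suc k)))}"
  have "(\<lambda>k. \<integral>\<^sup>+ y. indicator {-a..a} y * indicator (?A k) y \<partial>lborel) \<longlonglongrightarrow> 0"
  proof (rule nn_integral_indicator_LIMSEQ_0)
    have "(\<lambda>k. ennreal (inverse (real (Suc k)))) \<longlonglongrightarrow> ennreal 0"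
      by (intro tendsto_ennrealI LIMSEQ_inverse_real_of_nat)
    then have "\<forall>\<^sub>F k in sequentially. y \<notin> ?A k" if "y \<in> {-a..a}" for y
      using order_tendstoD(2)[of _ _ _ "q y"] pos[of y] that by (fastforce elim!: eventually_mono)
    then show "AE y in lborel. indicator {-a..a} y \<noteq> (0 :: ennreal) \<longrightarrow> (\<forall>\<^sub>F k in sequentially. y \<notin> ?A k)"
      by (intro AE_I2) (auto simp: indicator_def)
  qed (simp_all add: emeasure_lborel_Icc_eq)
  then obtain k where "(\<integral>\<^sup>+ y. indicator {-a..a} y * indicator (?A k) y \<partial>lborel) \<le> ennreal \<eta>"
    using \<eta> by (rule LIMSEQ_0_ennreal_le)
  moreover have "(\<integral>\<^sup>+ y. indicator {-a..a} y * indicator (?A k) y \<partial>lborel) = emeasure lborel (?A k)"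
  proof -
    have "(\<integral>\<^sup>+ y. indicator {-a..a} y * indicator (?A k) y \<partial>lborel) = (\<integral>\<^sup>+ y. indicator (?A k) y \<partial>lborel)"
      by (intro nn_integral_cong) (auto simp: indicator_def)
    also have "\<dots> = emeasure lborel (?A k)" by (rule nn_integral_indicator) measurable
    finally show ?thesis .
  qed
  ultimately show thesis by (intro that[of "inverse (real (Suc k))"]) (auto simp: inverse_le_1_iff)
qed

definition tail_mass :: "(real \<Rightarrow> ereal) \<Rightarrow> real \<Rightarrow> ennreal" where
  "tail_mass U L = (\<integral>\<^sup>+ y. exp_neg (U y) * indicator {y. L \<le> \<bar>y\<bar>} y \<partial>lborel)"

definition finite_beyond :: "(real \<Rightarrow> ereal) \<Rightarrow> real \<Rightarrow> bool" where
  "finite_beyond U L \<longleftrightarrow> (\<exists>K>L. \<forall>x. \<bar>x\<bar> < K \<longrightarrow> U x < \<infinity>)"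

definition sqrt_weight :: "(real \<Rightarrow> ereal) \<Rightarrow> real \<Rightarrow> ennreal" where
  "sqrt_weight U y = ennreal (sqrt (enn2real (exp_neg (U y))))"

lemma sqrt_weight_measurable:
  assumes "U \<in> borel_measurable borel"
  shows "sqrt_weight U \<in> borel_measurable borel"
  unfolding sqrt_weight_def[abs_def]
  by (intro measurable_compose[OF borel_measurable_exp_neg[OF assms]]) measurable

lemma sqrt_weight_sq:
  assumes "ereal c \<le> U y"
  shows "sqrt_weight U y * sqrt_weight U y = exp_neg (U y)"
proof -
  have "exp_neg (U y) < \<infinity>"
    using le_less_trans[OF exp_neg_le[OF assms] ennreal_less_top] by simp
  then show ?thesis by (simp add: sqrt_weight_def ennreal_mult[symmetric])
qed

lemma sqrt_weight_le:
  assumes "ereal c \<le> U y"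
  shows "sqrt_weight U y \<le> ennreal (sqrt (exp (- c)))"
  using enn2real_mono[OF exp_neg_le[OF assms] ennreal_less_top] by (simp add: sqrt_weight_def ennreal_leI)

lemma ex_edge_weight:
  fixes U :: "real \<Rightarrow> ereal" and c :: real
  assumes meas: "U \<in> borel_measurable borel" and even: "\<And>x. U x = U (- x)" and c_le_U: "\<And>x. ereal c \<le> U x"
    and int_fin: "(\<integral>\<^sup>+ x. exp_neg (U x) \<partial>lborel) < \<infinity>" and L_props: "0 < L" "finite_beyond U L"
  obtains Q I a \<epsilon> where "edge_weight (sqrt_weight U) Q I a \<epsilon>"
proof -
  define Q I a where "Q = max 1 (sqrt (exp (- c)))" and "I = max 1 (enn2real (\<integral>\<^sup>+ y. exp_neg (U y) \<partial>lborel))" and "a = min 1 L"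
  have pos: "0 < sqrt_weight U y" if "\<bar>y\<bar> \<le> a" for y
  proof -
    obtain K where "L < K" "\<And>x. \<bar>x\<bar> < K \<Longrightarrow> U x < \<infinity>" using L_props(2) by (auto simp: finite_beyond_def)
    then have "U y < \<infinity>" using that by (simp add: a_def)
    then have "sqrt_weight U y * sqrt_weight U y \<noteq> 0" using sqrt_weight_sq[of c U y] c_le_U by (simp add: exp_neg_eq_0_iff)
    then show ?thesis by (auto simp: zero_less_iff_neq_zero)
  qed
  obtain \<epsilon> where \<epsilon>: "0 < \<epsilon>" "\<epsilon> \<le> 1" "emeasure lborel {y \<in> {-a..a}. sqrt_weight U y < ennreal \<epsilon>} \<le> ennreal (a / 8)"
  proof (rule ex_small_sublevel_set[OF sqrt_weight_measurable[OF meas] pos])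
    show "0 < a / 8" using L_props(1) by (simp add: a_def)
  qed auto
  have "edge_weight (sqrt_weight U) Q I a \<epsilon>"
  proof
    show "sqrt_weight U (- y) = sqrt_weight U y" for y by (simp add: sqrt_weight_def even[of y])
    show "sqrt_weight U y \<le> ennreal Q" for y
      by (rule order_trans[OF sqrt_weight_le[OF c_le_U]]) (simp add: Q_def ennreal_leI)
    have "(\<integral>\<^sup>+ y. exp_neg (U y) \<partial>lborel) = ennreal (enn2real (\<integral>\<^sup>+ y. exp_neg (U y) \<partial>lborel))" using int_fin by simp
    also have "\<dots> \<le> ennreal I" unfolding I_def by (intro ennreal_leI) simp
    finally show "(\<integral>\<^sup>+ y. sqrt_weight U y * sqrt_weight U y \<partial>lborel) \<le> ennreal I" by (simp add: sqrt_weight_sq[OF c_le_U])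
  qed (use sqrt_weight_measurable[OF meas] \<epsilon> L_props(1) in \<open>auto simp: Q_def I_def a_def\<close>)
  then show thesis by (rule that)
qed

lemma (in edge_weight) controlled_gradientsI:
  fixes \<delta> \<tau> L :: real
  assumes q_sq: "\<And>y. q y * q y = exp_neg (U y)" and U_not_MInf: "\<And>y. U y \<noteq> -\<infinity>"
    and n_pos: "n \<ge> 1" and finite: "finite_beyond U L" and "0 < \<delta>"
    and \<tau>: "0 \<le> \<tau>" "tail_mass U L \<le> ennreal \<tau>" "mass_ratio * \<tau> \<le> \<delta> ^ 8"
  shows "controlled_gradients \<delta> L n U"
proof -
  interpret torus_model n q Q I a \<epsilon> L by unfold_locales (rule n_pos)
  have tail: "tail \<le> ennreal \<tau>" using \<tau>(2) by (simp add: tail_def tail_mass_def q_sq)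
  have "gibbs_prob n U (large_gradients L S) \<le> ennreal (\<delta> ^ card S)" if S_edges: "S \<subseteq> torus_E n" for S
  proof -
    have "prob (symmetrize S) ^ 8 \<le> (mass_ratio * \<tau>) ^ card S" by (rule prob_power_8_le[OF S_edges \<tau>(1) tail])
    also have "\<dots> \<le> (\<delta> ^ 8) ^ card S" using \<tau> mass_ratio_ge_1 by (intro power_mono) auto
    also have "\<dots> = (\<delta> ^ card S) ^ 8" by (simp add: power_mult[symmetric] mult.commute)
    finally have "prob (symmetrize S) \<le> \<delta> ^ card S"
      using \<open>0 < \<delta>\<close> by (subst (asm) power_mono_iff) (auto simp: prob_nonneg)
    then show ?thesis using gibbs_prob_large_gradients[OF q_sq U_not_MInf S_edges] by (simp add: ennreal_leI)
  qed
  moreover have "0 < partition_fn n U" "partition_fn n U < \<infinity>"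
    using mass_empty_pos mass_finite[of "{}"] unfolding partition_fn_eq_mass[OF q_sq U_not_MInf]
    by (simp_all add: enn2real_positive_iff)
  ultimately show ?thesis
    using finite by (simp add: controlled_gradients_def large_gradients_def finite_beyond_def)
qed

definition exhausting_thresholds :: "(real \<Rightarrow> ereal) \<Rightarrow> (nat \<Rightarrow> real) \<Rightarrow> bool" where
  "exhausting_thresholds U L \<longleftrightarrow> (\<forall>k. 0 < L k \<and> finite_beyond U (L k)) \<and>
    (AE x in lborel. U x \<noteq> \<infinity> \<longrightarrow> (\<forall>\<^sub>F k in sequentially. \<bar>x\<bar> < L k))"

lemma exhausting_thresholds_finite:
  assumes "\<And>x. U x < \<infinity>"
  shows "exhausting_thresholds U (\<lambda>k. real (Suc k))"
  unfolding exhausting_thresholds_def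
proof (intro conjI allI)
  show "finite_beyond U (real (Suc k))" for k
    using assms unfolding finite_beyond_def by (intro exI[of _ "real (Suc k) + 1"]) simp
  have "filterlim (\<lambda>k. real (Suc k)) at_top sequentially"
    by (rule filterlim_compose[OF filterlim_real_sequentially filterlim_Suc])
  then show "AE x in lborel. U x \<noteq> \<infinity> \<longrightarrow> (\<forall>\<^sub>F k in sequentially. \<bar>x\<bar> < real (Suc k))"
    by (simp add: filterlim_at_top_dense)
qed simp

lemma exhausting_thresholds_hardcore:
  fixes K :: real
  assumes K_range: "0 < K" "\<And>x. \<bar>x\<bar> < K \<Longrightarrow> U x < \<infinity>" "\<And>x. K < \<bar>x\<bar> \<Longrightarrow> U x = \<infinity>"
  shows "exhausting_thresholds U (\<lambda>k. K * (1 - inverse (real (Suc (Suc k)))))"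
proof -
  define L where "L = (\<lambda>k. K * (1 - inverse (real (Suc (Suc k)))))"
  have "0 < L k" "L k < K" for k
    using K_range(1) by (simp_all add: L_def inverse_less_1_iff zero_less_mult_iff)
  then have bounds: "0 < L k" "finite_beyond U (L k)" for k
    using K_range(2) unfolding finite_beyond_def by blast+
  have "L \<longlonglongrightarrow> K * (1 - 0)"
    unfolding L_def by (intro tendsto_intros LIMSEQ_Suc[OF LIMSEQ_inverse_real_of_nat])
  then have limit: "L \<longlonglongrightarrow> K" by simp
  have "AE x in lborel. U x \<noteq> \<infinity> \<longrightarrow> (\<forall>\<^sub>F k in sequentially. \<bar>x\<bar> < L k)"
    using AE_lborel_singleton[of K] AE_lborel_singleton[of "- K"]
  proof eventually_elim
    case (elim x)
    then have "\<bar>x\<bar> \<noteq> K" by linarith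
    then have "U x \<noteq> \<infinity> \<Longrightarrow> \<bar>x\<bar> < K" using K_range(3)[of x] by force
    then show ?case using order_tendstoD(1)[OF limit] by blast
  qed
  then show ?thesis unfolding exhausting_thresholds_def L_def[symmetric] using bounds by blast
qed

lemma ex_small_tail_mass:
  fixes U :: "real \<Rightarrow> ereal"
  assumes meas: "U \<in> borel_measurable borel" and int_fin: "(\<integral>\<^sup>+ x. exp_neg (U x) \<partial>lborel) < \<infinity>"
    and finite_or_hardcore: "(\<forall>x. U x < \<infinity>) \<or>
     (\<exists>K::real. 0 < K \<and> (\<forall>x. \<bar>x\<bar> < K \<longrightarrow> U x < \<infinity>) \<and> (\<forall>x. \<bar>x\<bar> > K \<longrightarrow> U x = \<infinity>))"
    and "0 < \<tau>"
  obtains L where "0 < L" "finite_beyond U L" "tail_mass U L \<le> ennreal \<tau>"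
proof -
  obtain L where "exhausting_thresholds U L"
    using finite_or_hardcore exhausting_thresholds_finite exhausting_thresholds_hardcore by metis
  then have L_props: "\<And>k. 0 < L k" "\<And>k. finite_beyond U (L k)"
    "AE x in lborel. U x \<noteq> \<infinity> \<longrightarrow> (\<forall>\<^sub>F k in sequentially. \<bar>x\<bar> < L k)"
    by (auto simp: exhausting_thresholds_def)
  have "(\<lambda>k. tail_mass U (L k)) \<longlonglongrightarrow> 0"
    unfolding tail_mass_def
  proof (rule nn_integral_indicator_LIMSEQ_0[OF _ int_fin])
    show "AE x in lborel. exp_neg (U x) \<noteq> 0 \<longrightarrow> (\<forall>\<^sub>F k in sequentially. x \<notin> {y. L k \<le> \<bar>y\<bar>})"
      using L_props(3) by eventually_elim (auto simp: exp_neg_def not_le)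
  qed (use borel_measurable_exp_neg[OF meas] in simp_all)
  then obtain k where "tail_mass U (L k) \<le> ennreal \<tau>" using \<open>0 < \<tau>\<close> by (rule LIMSEQ_0_ennreal_le)
  then show thesis using L_props(1,2) by (rule that[rotated 2])
qed

theorem theorem3p2:
  fixes U :: "real \<Rightarrow> ereal"
  assumes meas: "U \<in> borel_measurable borel"
    and sym: "\<And>x. U x = U (- x)"
    and bdd_below: "\<exists>c::real. \<forall>x. ereal c \<le> U x"
    and int_pos: "0 < (\<integral>\<^sup>+ x. exp_neg (U x) \<partial>lborel)"
    and int_fin: "(\<integral>\<^sup>+ x. exp_neg (U x) \<partial>lborel) < \<infinity>"
    and finite_or_hardcore:
      "(\<forall>x. U x < \<infinity>) \<or>
       (\<exists>K::real. 0 < K \<and> (\<forall>x. \<bar>x\<bar> < K \<longrightarrow> U x < \<infinity>) \<and> (\<forall>x. \<bar>x\<bar> > K \<longrightarrow> U x = \<infinity>))"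
  shows "\<forall>\<delta>::real. 0 < \<delta> \<and> \<delta> < 1 \<longrightarrow>
           (\<exists>L::real. 0 < L \<and> (\<forall>n::nat. n \<ge> 1 \<longrightarrow> controlled_gradients \<delta> L n U))"
proof (intro allI impI)
  fix \<delta> :: real assume \<delta>: "0 < \<delta> \<and> \<delta> < 1"
  obtain c :: real where c_le_U: "\<And>x. ereal c \<le> U x" using bdd_below by blast
  obtain L0 where "0 < L0" "finite_beyond U L0"
    using ex_small_tail_mass[OF meas int_fin finite_or_hardcore zero_less_one] by blast
  then obtain Q I a \<epsilon> where "edge_weight (sqrt_weight U) Q I a \<epsilon>"
    using ex_edge_weight[OF meas sym c_le_U int_fin] by blast
  then interpret edge_weight "sqrt_weight U" Q I a \<epsilon> .
  define \<tau> where "\<tau> = \<delta> ^ 8 / mass_ratio"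
  have \<tau>: "0 < \<tau>" "mass_ratio * \<tau> \<le> \<delta> ^ 8" using \<delta> mass_ratio_ge_1 by (simp_all add: \<tau>_def)
  obtain L where L_props: "0 < L" "finite_beyond U L" "tail_mass U L \<le> ennreal \<tau>"
    using ex_small_tail_mass[OF meas int_fin finite_or_hardcore \<tau>(1)] by blast
  have "U y \<noteq> -\<infinity>" for y using c_le_U[of y] by auto
  then have "controlled_gradients \<delta> L n U" if "n \<ge> 1" for n
    using that L_props(2,3) \<delta> \<tau> sqrt_weight_sq[OF c_le_U] by (intro controlled_gradientsI[where \<tau> = \<tau>]) simp_all
  then show "\<exists>L>0. \<forall>n\<ge>1. controlled_gradients \<delta> L n U" using L_props(1) by blast
qed

end
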